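(* Let $q\colon(K,G,\varphi)\to(L,G,\psi)$ be an open pseudoisometric extension of topological dynamical systems, where both $(K,G,\varphi)$ and $(L,G,\psi)$ are topologically ergodic. Then $q$ has a unique relatively invariant measure, and this relatively invariant measure is fully supported.
   Context: All compact spaces are Hausdorff. A topological dynamical system $(K,G,\varphi)$ consists of a nonempty compact space $K$, a Hausdorff topological group $G$ and a continuous action $\varphi\colon G\times K\to K$; write $\varphi_g=\varphi(g,\cdot)$. An extension $q\colon(K,G,\varphi)\to(L,G,\psi)$ is a continuous surjection $q\colon K\to L$ with $q\circ\varphi_g=\psi_g\circ q$ for all $g\in G$; it is open if $q$ is an open map. Write $K_l=q^{-1}(l)$, $gl=\psi_g(l)$ and $K\times_qK=\{(x,y)\in K\times K: q(x)=q(y)\}$. $(K,G,\varphi)$ is topologically ergodic if the only $f\in\mathrm C(K)$ with $f\circ\varphi_g=f$ for all $g\in G$ are the constant functions. $q$ is pseudoisometric if there is a set $P$ of continuous maps $p\colon K\times_qK\to[0,\infty)$ such that for every $l\in L$ each $p|_{K_l\times K_l}$ ($p\in P$) is a pseudometric on $K_l$, these pseudometrics ($p\in P$) generate the topology of $K_l$, and $p(\varphi_gx,\varphi_gy)=p(x,y)$ for all $p\in P$, $(x,y)\in K\times_qK$, $g\in G$. Let $\mathrm P(K)$ be the set of regular Borel probability measures on $K$ with the weak* topology as a subset of $\mathrm C(K)'$. A relatively invariant measure for $q$ is a weak*-continuous map $\mu\colon L\to\mathrm P(K)$, $l\mapsto\mu_l$, with $\operatorname{supp}\mu_l\subset K_l$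 and $(\varphi_g)_*\mu_l=\mu_{gl}$ for all $g\in G$, $l\in L$. It is fully supported if $\operatorname{supp}\mu_l=K_l$ for every $l\in L$. *)

theory Defs
  imports "HOL-Probability.Probability_Measure"
begin

text \<open>
  Compact spaces are types of class \<open>t2_space\<close> whose universe is compact. Groups are
  written additively, as in the class \<open>topological_group_add\<close>, which does not
  assume commutativity.
\<close>

definition top_dyn_sys ::
  "('g::{topological_group_add, t2_space} \<Rightarrow> 'k::t2_space \<Rightarrow> 'k) \<Rightarrow> bool" where
  "top_dyn_sys \<phi> \<longleftrightarrow>
     compact (UNIV :: 'k set) \<and>
     continuous_on UNIV (\<lambda>(g, x). \<phi> g x) \<and>
     (\<forall>x. \<phi> 0 x = x) \<and>
     (\<forall>g h x. \<phi> (g + h) x = \<phi> g (\<phi> h x))"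

definition extension ::
  "('g::{topological_group_add, t2_space} \<Rightarrow> 'k::t2_space \<Rightarrow> 'k) \<Rightarrow> ('g \<Rightarrow> 'l::t2_space \<Rightarrow> 'l)
     \<Rightarrow> ('k \<Rightarrow> 'l) \<Rightarrow> bool" where
  "extension \<phi> \<psi> q \<longleftrightarrow>
     top_dyn_sys \<phi> \<and> top_dyn_sys \<psi> \<and>
     continuous_on UNIV q \<and> surj q \<and>
     (\<forall>g. q \<circ> \<phi> g = \<psi> g \<circ> q)"

definition open_extension ::
  "('g::{topological_group_add, t2_space} \<Rightarrow> 'k::t2_space \<Rightarrow> 'k) \<Rightarrow> ('g \<Rightarrow> 'l::t2_space \<Rightarrow> 'l)
     \<Rightarrow> ('k \<Rightarrow> 'l) \<Rightarrow> bool" where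
  "open_extension \<phi> \<psi> q \<longleftrightarrow> extension \<phi> \<psi> q \<and> open_map euclidean euclidean q"

text \<open>The space \<open>C(K)\<close>; as usual in this context, functions are complex-valued.\<close>

definition cont_funs :: "('k::topological_space \<Rightarrow> complex) set" where
  "cont_funs = {f. continuous_on UNIV f}"

definition top_ergodic :: "('g \<Rightarrow> 'k::topological_space \<Rightarrow> 'k) \<Rightarrow> bool" where
  "top_ergodic \<phi> \<longleftrightarrow>
     (\<forall>f \<in> cont_funs. (\<forall>g. f \<circ> \<phi> g = f) \<longrightarrow> f constant_on UNIV)"

definition fiber :: "('k \<Rightarrow> 'l) \<Rightarrow> 'l \<Rightarrow> 'k set" where
  "fiber q l = q -` {l}"

definition fiber_prod :: "('k \<Rightarrow> 'l) \<Rightarrow> ('k \<times> 'k) set" where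
  "fiber_prod q = {(x, y). q x = q y}"

definition pseudometric_on :: "'k set \<Rightarrow> ('k \<times> 'k \<Rightarrow> real) \<Rightarrow> bool" where
  "pseudometric_on S p \<longleftrightarrow>
     (\<forall>x\<in>S. \<forall>y\<in>S. 0 \<le> p (x, y)) \<and>
     (\<forall>x\<in>S. p (x, x) = 0) \<and>
     (\<forall>x\<in>S. \<forall>y\<in>S. p (x, y) = p (y, x)) \<and>
     (\<forall>x\<in>S. \<forall>y\<in>S. \<forall>z\<in>S. p (x, z) \<le> p (x, y) + p (y, z))"

text \<open>
  The topology on \<open>S\<close> with the open balls of the members of \<open>P\<close> as a subbase. Inserting
  \<open>S\<close> itself only matters for empty \<open>P\<close>, which then generates the indiscrete topology.
\<close>

definition pseudometrics_topology :: "'k set \<Rightarrow> ('k \<times> 'k \<Rightarrow> real) set \<Rightarrow> 'k topology" where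
  "pseudometrics_topology S P =
     topology_generated_by
       (insert S {{y \<in> S. p (x, y) < r} | p x r. p \<in> P \<and> x \<in> S \<and> 0 < r})"

text \<open>
  Members of \<open>P\<close> are total functions, but only their restrictions to the fibre product
  are constrained.
\<close>

definition pseudoisometric ::
  "('g \<Rightarrow> 'k::topological_space \<Rightarrow> 'k) \<Rightarrow> ('k \<Rightarrow> 'l) \<Rightarrow> bool" where
  "pseudoisometric \<phi> q \<longleftrightarrow>
     (\<exists>P :: ('k \<times> 'k \<Rightarrow> real) set.
        (\<forall>p\<in>P. continuous_on (fiber_prod q) p \<and> (\<forall>z\<in>fiber_prod q. 0 \<le> p z)) \<and>
        (\<forall>l. (\<forall>p\<in>P. pseudometric_on (fiber q l) p) \<and>
             pseudometrics_topology (fiber q l) P = top_of_set (fiber q l)) \<and>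
        (\<forall>p\<in>P. \<forall>(x, y)\<in>fiber_prod q. \<forall>g. p (\<phi> g x, \<phi> g y) = p (x, y)))"

definition regular_measure :: "'k::topological_space measure \<Rightarrow> bool" where
  "regular_measure M \<longleftrightarrow>
     (\<forall>A \<in> sets M.
        emeasure M A = (INF U \<in> {U. open U \<and> A \<subseteq> U}. emeasure M U) \<and>
        emeasure M A = (SUP C \<in> {C. compact C \<and> C \<subseteq> A}. emeasure M C))"

definition prob_measures :: "'k::topological_space measure set" where
  "prob_measures = {M. sets M = sets borel \<and> prob_space M \<and> regular_measure M}"

text \<open>
  A measure is identified with the functional \<open>f \<mapsto> \<integral> f dM\<close> on \<open>C(K)\<close>; the weak* topology is
  that of pointwise convergence on \<open>C(K)\<close>.
\<close>

definition weak_star_topology :: "'k::topological_space measure topology" where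
  "weak_star_topology =
     pullback_topology prob_measures (\<lambda>M. \<lambda>f\<in>cont_funs. integral\<^sup>L M f)
       (product_topology (\<lambda>f. euclidean) cont_funs)"

definition measure_support :: "'k::topological_space measure \<Rightarrow> 'k set" where
  "measure_support M = {x. \<forall>U. open U \<and> x \<in> U \<longrightarrow> 0 < emeasure M U}"

definition relatively_invariant_measure ::
  "('g \<Rightarrow> 'k::topological_space \<Rightarrow> 'k) \<Rightarrow> ('g \<Rightarrow> 'l::topological_space \<Rightarrow> 'l)
     \<Rightarrow> ('k \<Rightarrow> 'l) \<Rightarrow> ('l \<Rightarrow> 'k measure) \<Rightarrow> bool" where
  "relatively_invariant_measure \<phi> \<psi> q \<mu> \<longleftrightarrow>
     continuous_map euclidean weak_star_topology \<mu> \<and>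
     (\<forall>l. measure_support (\<mu> l) \<subseteq> fiber q l) \<and>
     (\<forall>g l. distr (\<mu> l) borel (\<phi> g) = \<mu> (\<psi> g l))"

definition fully_supported :: "('k::topological_space \<Rightarrow> 'l) \<Rightarrow> ('l \<Rightarrow> 'k measure) \<Rightarrow> bool" where
  "fully_supported q \<mu> \<longleftrightarrow> (\<forall>l. measure_support (\<mu> l) = fiber q l)"

lemma topspace_weak_star_topology: "topspace weak_star_topology = prob_measures"
  by (auto simp: weak_star_topology_def topspace_pullback_topology)

end

theory Submission
  imports Defs
begin

text \<open>
  Why the theorem holds: a pseudoisometric extension equips the compact fibres with invariant
  pseudometrics, so that each fibre carries an analogue of Haar measure. Ergodicity makes these
  measures depend continuously on the fibre, and makes them unique; it is used for two
  continuous invariant functions, which have to be constant.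

  The first one is a function on \<open>L\<close>. Given finitely many points of the fibre over \<open>l\<close> and
  finitely many of the pseudometrics, measure how well the distances between these points can be
  imitated by points of the fibre over \<open>m\<close>. Since \<open>q\<close> is open, the optimal error is continuous
  in \<open>m\<close> (\<open>continuous_fibre_Inf\<close>), and it is zero for \<open>m = l\<close>, hence for all \<open>m\<close>. With Tychonoff's
  theorem it follows that any two fibres are isometric (\<open>isos_nonempty\<close>).

  Existence. The number of small balls needed to cover a compact subset of a fibre, relative to
  the number needed for the whole fibre, has a limit point as the balls shrink
  (\<open>ratio_limit\<close>). This is a content, from which a regular Borel measure on the fibre
  arises in the usual way (locale \<open>content\<close>). The construction is canonical, so every isometry
  between fibres transports one of these measures to the other (\<open>distr_fibre_measure\<close>); in
  particular so do the maps \<open>\<phi> g\<close>. Weak* continuity holds because the isometries out of a fixed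
  fibre form a compact, equicontinuous set of maps which reaches all fibres
  (\<open>continuous_fibre_integral\<close>).

  Uniqueness and full support. If \<open>\<nu>\<close> is relatively invariant and \<open>d\<close> is one of the
  pseudometrics, then \<open>x \<mapsto> \<integral> max 0 (1 - d x y) d\<nu>\<^bsub>q x\<^esub>(y)\<close> is the second continuous invariant
  function, now on \<open>K\<close> (\<open>mean_constant\<close>). Its constant value is positive, so balls around any point
  have positive measure. For two relatively invariant measures, Fubini's theorem for the kernel
  \<open>f x * max 0 (1 - d x y)\<close> shows that \<open>f\<close> has the same integral with respect to both, up to an
  error which tends to zero as \<open>d\<close> becomes finer (\<open>mean_swap\<close>).
\<close>

section \<open>Compact Hausdorff spaces\<close>

lemma normal_space_compact_t2:
  assumes "compact (UNIV :: 'a::t2_space set)"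
  shows "normal_space (euclidean :: 'a topology)"
proof (rule compact_Hausdorff_or_regular_imp_normal_space)
  show "compact_space (euclidean :: 'a topology)"
    using assms by (simp add: compact_space_def)
  have "Hausdorff_space (euclidean :: 'a topology)"
    unfolding Hausdorff_space_def disjnt_def by (metis hausdorff open_openin)
  then show "Hausdorff_space (euclidean :: 'a topology) \<or> regular_space (euclidean :: 'a topology)" ..
qed

lemma Urysohn_compact_t2:
  fixes A B :: "'a::t2_space set"
  assumes "compact (UNIV :: 'a set)" "closed A" "closed B" "A \<inter> B = {}"
  shows "\<exists>f :: 'a \<Rightarrow> real. continuous_on UNIV f \<and> (\<forall>x. f x \<in> {0..1}) \<and>
    (\<forall>x\<in>A. f x = 0) \<and> (\<forall>x\<in>B. f x = 1)"
proof -
  obtain f where f: "continuous_map euclidean (top_of_set {0..1::real}) f" "f ` A \<subseteq> {0}" "f ` B \<subseteq> {1}"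
    by (rule Urysohn_lemma[OF normal_space_compact_t2[OF assms(1)], of A B 0 1])
       (use assms in \<open>auto simp: disjnt_def\<close>)
  then show ?thesis
    by (intro exI[of _ f]) (auto simp: continuous_map_in_subtopology image_subset_iff)
qed

lemma Tietze_compact_t2:
  fixes f :: "'a::t2_space \<Rightarrow> real"
  assumes "compact (UNIV :: 'a set)" "closed S" "continuous_on S f"
  shows "\<exists>g. continuous_on UNIV g \<and> (\<forall>x\<in>S. g x = f x)"
  using normal_space_compact_t2[OF assms(1)] assms(2,3)
  unfolding normal_space_iff_Tietze by simp

lemma closed_iff_compact:
  assumes "compact (UNIV :: 'a::t2_space set)"
  shows "closed C \<longleftrightarrow> compact (C :: 'a set)"
  using assms compact_imp_closed compact_Int_closed[of UNIV C] by auto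

lemma compact_UNIV_Times:
  assumes "compact (UNIV :: 'a::topological_space set)" "compact (UNIV :: 'b::topological_space set)"
  shows "compact (UNIV :: ('a \<times> 'b) set)"
  using compact_Times[OF assms] by simp

lemma compact_UNIV_fun:
  assumes "compact (UNIV :: 'b::topological_space set)"
  shows "compact (UNIV :: ('a \<Rightarrow> 'b) set)"
proof -
  have "compactin (product_topology (\<lambda>_::'a. euclidean :: 'b topology) UNIV) (PiE UNIV (\<lambda>_. UNIV))"
    unfolding compactin_PiE using assms by simp
  then show ?thesis
    by (simp add: euclidean_product_topology PiE_UNIV_domain)
qed

text \<open>
  On nonmetrizable spaces the product of the Borel \<open>\<sigma>\<close>-algebras can be smaller than the Borel
  \<open>\<sigma>\<close>-algebra of the product, so continuity alone does not give measurability. Compactness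
  does: up to a given uniform error, \<open>h\<close> only depends on \<open>x\<close> through the first member of a
  finite open cover that contains \<open>x\<close>. This is what makes Fubini's theorem available for
  continuous kernels.
\<close>

lemma borel_measurable_kernel:
  fixes h :: "'a::topological_space \<Rightarrow> 'b::topological_space \<Rightarrow> real"
  assumes "compact (UNIV :: 'a set)" "compact (UNIV :: 'b set)"
    and h: "continuous_on UNIV (\<lambda>(x, y). h x y)"
  shows "(\<lambda>(x, y). h x y) \<in> borel_measurable (borel \<Otimes>\<^sub>M borel)"
proof -
  have app: "\<exists>f \<in> borel_measurable (borel \<Otimes>\<^sub>M borel). \<forall>x y. \<bar>f (x, y) - h x y\<bar> \<le> e" if "e > 0" for e
  proof -
    \<comment> \<open>\<open>X x0\<close> consists of points whose sections of \<open>h\<close> are uniformly close to that of \<open>x0\<close>.\<close>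
    have "\<exists>X. x0 \<in> X \<and> open X \<and> (\<forall>x\<in>X. \<forall>y. \<bar>h x y - h x0 y\<bar> \<le> e)" for x0
    proof -
      have "continuous_on (UNIV \<times> UNIV) (\<lambda>(x, y). h x y)" using h by simp
      then obtain X where "x0 \<in> X" "open X"
        "\<forall>x\<in>X \<inter> UNIV. \<forall>y\<in>UNIV. dist (case (x, y) of (x, y) \<Rightarrow> h x y) (case (x0, y) of (x, y) \<Rightarrow> h x y) \<le> e"
        by (rule continuous_on_prod_compactE[OF _ assms(2) UNIV_I \<open>e > 0\<close>])
      then have "x0 \<in> X \<and> open X \<and> (\<forall>x\<in>X. \<forall>y. \<bar>h x y - h x0 y\<bar> \<le> e)"
        by (simp add: dist_real_def)
      then show ?thesis by blast
    qed
    then obtain X where "\<And>x0. x0 \<in> X x0 \<and> open (X x0) \<and> (\<forall>x\<in>X x0. \<forall>y. \<bar>h x y - h x0 y\<bar> \<le> e)"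
      by metis
    then have X: "\<And>x. x \<in> X x" "\<And>x. open (X x)"
      "\<And>x x0 y. x \<in> X x0 \<Longrightarrow> \<bar>h x y - h x0 y\<bar> \<le> e" by auto
    have "UNIV \<subseteq> (\<Union>x\<in>UNIV. X x)" using X(1) by auto
    then obtain F where F: "finite F" "UNIV \<subseteq> (\<Union>x\<in>F. X x)"
      using compactE_image[OF assms(1), of UNIV X] X(2) by metis
    have "F \<noteq> {}" using F by auto
    define a where "a = from_nat_into F"
    define k where "k x = (LEAST i. x \<in> X (a i))" for x
    have "\<exists>i. x \<in> X (a i)" for x
    proof -
      obtain x0 where "x0 \<in> F" "x \<in> X x0" using F by blast
      moreover have "range a = F"
        unfolding a_def using F \<open>F \<noteq> {}\<close> by (simp add: range_from_nat_into countable_finite)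
      ultimately show ?thesis by (metis rangeE)
    qed
    then have k: "x \<in> X (a (k x))" for x unfolding k_def by (rule LeastI_ex)
    have [measurable]: "k \<in> measurable borel (count_space UNIV)"
      unfolding k_def by (rule measurable_Least) (simp add: X(2) pred_def)
    have [measurable]: "h x \<in> borel_measurable borel" for x
      by (intro borel_measurable_continuous_onI continuous_on_compose2[OF h, of UNIV "\<lambda>y. (x, y)", simplified])
         (auto intro!: continuous_intros)
    have "(\<lambda>(x, y). h (a (k x)) y) \<in> borel_measurable (borel \<Otimes>\<^sub>M borel)"
      unfolding split_beta
      by (rule measurable_compose_countable[where f="\<lambda>i z. h (a i) (snd z)" and g="\<lambda>z. k (fst z)"]) measurable
    then show ?thesis
      by (rule bexI[rotated]) (use X(3)[OF k] in \<open>auto simp: abs_minus_commute\<close>)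
  qed
  define e where "e n = inverse (real (Suc n))" for n
  have "\<forall>n. \<exists>f \<in> borel_measurable (borel \<Otimes>\<^sub>M borel). \<forall>x y. \<bar>f (x, y) - h x y\<bar> \<le> e n"
    by (intro allI app) (simp add: e_def)
  then obtain f where f: "\<And>n. f n \<in> borel_measurable (borel \<Otimes>\<^sub>M borel)"
    "\<And>n x y. \<bar>f n (x, y) - h x y\<bar> \<le> e n" by metis
  show ?thesis
  proof (rule borel_measurable_LIMSEQ_metric[of f])
    show "(\<lambda>n. f n z) \<longlonglongrightarrow> (case z of (x, y) \<Rightarrow> h x y)" for z
    proof (rule LIM_zero_cancel, rule tendsto_0_le[OF LIMSEQ_inverse_real_of_nat, where K=1])
      show "\<forall>\<^sub>F n in sequentially. norm (f n z - (case z of (x, y) \<Rightarrow> h x y)) \<le> norm (inverse (real (Suc n))) * 1"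
        using f(2) by (auto simp: e_def split: prod.splits)
    qed
  qed (rule f)
qed

section \<open>Regular measures from contents\<close>

text \<open>
  Halmos' construction of a regular Borel measure from a content. A content is defined on
  compact sets only and need not be the restriction of a measure; passing to open sets by
  suprema and to arbitrary sets by infima regularizes it. Subadditivity makes the result an
  outer measure, and additivity on disjoint compact sets makes open sets measurable for it in
  the sense of Caratheodory.
\<close>

locale content =
  fixes \<Lambda> :: "'a::t2_space set \<Rightarrow> ennreal"
  assumes compact_space: "compact (UNIV :: 'a set)"
    and mono: "compact C \<Longrightarrow> compact D \<Longrightarrow> C \<subseteq> D \<Longrightarrow> \<Lambda> C \<le> \<Lambda> D"
    and subadditive: "compact C \<Longrightarrow> compact D \<Longrightarrow> \<Lambda> (C \<union> D) \<le> \<Lambda> C + \<Lambda> D"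
    and additive: "compact C \<Longrightarrow> compact D \<Longrightarrow> C \<inter> D = {} \<Longrightarrow> \<Lambda> (C \<union> D) = \<Lambda> C + \<Lambda> D"
    and total: "\<Lambda> UNIV = 1"
begin

definition inner :: "'a set \<Rightarrow> ennreal" where
  "inner U = (SUP C \<in> {C. compact C \<and> C \<subseteq> U}. \<Lambda> C)"

definition outer :: "'a set \<Rightarrow> ennreal" where
  "outer A = (INF U \<in> {U. open U \<and> A \<subseteq> U}. inner U)"

definition radon :: "'a measure" where
  "radon = measure_of UNIV (sets borel) outer"

lemmas closed_compact = closed_iff_compact[OF compact_space]

lemma empty: "\<Lambda> {} = 0"
proof -
  have "\<Lambda> {} \<le> 1" using mono[of "{}" UNIV] compact_space total by simp
  moreover have "\<Lambda> {} + \<Lambda> {} = \<Lambda> {} + 0" using additive[of "{}" "{}"] by simp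
  ultimately show ?thesis
    by (metis ennreal_add_left_cancel ennreal_one_less_top infinity_ennreal_def leD)
qed

lemma le_inner: "compact C \<Longrightarrow> C \<subseteq> U \<Longrightarrow> \<Lambda> C \<le> inner U"
  unfolding inner_def by (rule SUP_upper) simp

lemma inner_leI: "(\<And>C. compact C \<Longrightarrow> C \<subseteq> U \<Longrightarrow> \<Lambda> C \<le> b) \<Longrightarrow> inner U \<le> b"
  unfolding inner_def by (rule SUP_least) simp

lemma inner_mono: "U \<subseteq> V \<Longrightarrow> inner U \<le> inner V"
  by (rule inner_leI) (auto intro: le_inner)

lemma inner_le_1: "inner U \<le> 1"
  by (rule inner_leI) (metis mono compact_space total subset_UNIV)

text \<open>
  Normality lets a compact subset of \<open>U \<union> V\<close> be cut into a compact subset of \<open>U\<close> and one of \<open>V\<close>.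
\<close>

lemma inner_Un:
  assumes "open U" "open V"
  shows "inner (U \<union> V) \<le> inner U + inner V"
proof (rule inner_leI)
  fix C assume C: "compact C" "C \<subseteq> U \<union> V"
  have "closed (C - U)" "closed (C - V)" "(C - U) \<inter> (C - V) = {}"
    using C assms by (auto simp: closed_compact intro: compact_diff)
  then obtain U' V' where UV: "open U'" "open V'" "C - U \<subseteq> U'" "C - V \<subseteq> V'" "U' \<inter> V' = {}"
    using normal_space_compact_t2[OF compact_space]
    unfolding normal_space_def disjnt_def by (metis closed_closedin open_openin)
  have cpt: "compact (C - U')" "compact (C - V')" using C UV by (auto intro: compact_diff)
  have "C = (C - U') \<union> (C - V')" using UV by auto
  then have "\<Lambda> C \<le> \<Lambda> (C - U') + \<Lambda> (C - V')" using subadditive[OF cpt] by simp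
  also have "\<dots> \<le> inner U + inner V"
    by (intro add_mono le_inner cpt) (use UV in auto)
  finally show "\<Lambda> C \<le> inner U + inner V" .
qed

lemma inner_UN_finite:
  fixes n :: nat
  assumes "\<And>n. open (U n)"
  shows "inner (\<Union>i<n. U i) \<le> (\<Sum>i<n. inner (U i))"
proof (induction n)
  case 0
  have "inner {} \<le> 0" by (rule inner_leI) (simp add: empty)
  then show ?case by simp
next
  case (Suc n)
  have "inner (\<Union>i<Suc n. U i) \<le> inner (\<Union>i<n. U i) + inner (U n)"
    using inner_Un[of "\<Union>i<n. U i" "U n"] assms by (auto simp: lessThan_Suc Un_commute)
  also have "\<dots> \<le> (\<Sum>i<n. inner (U i)) + inner (U n)" using Suc by (rule add_right_mono)
  finally show ?case by simp
qed

lemma inner_UN: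
  assumes U: "\<And>n::nat. open (U n)"
  shows "inner (\<Union>n. U n) \<le> (\<Sum>n. inner (U n))"
proof (rule inner_leI)
  fix C assume C: "compact C" "C \<subseteq> (\<Union>n. U n)"
  obtain F where F: "finite F" "C \<subseteq> (\<Union>n\<in>F. U n)"
    using compactE_image[OF C(1), of UNIV U] C U by metis
  then obtain N where "F \<subseteq> {..<N}" using finite_nat_bounded by blast
  then have "C \<subseteq> (\<Union>n<N. U n)" using F by blast
  then have "\<Lambda> C \<le> inner (\<Union>n<N. U n)" by (rule le_inner[OF C(1)])
  also have "\<dots> \<le> (\<Sum>n<N. inner (U n))" by (rule inner_UN_finite) (rule U)
  also have "\<dots> \<le> (\<Sum>n. inner (U n))" by (rule sum_le_suminf) auto
  finally show "\<Lambda> C \<le> (\<Sum>n. inner (U n))" .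
qed

lemma outer_mono: "A \<subseteq> B \<Longrightarrow> outer A \<le> outer B"
  unfolding outer_def by (rule INF_superset_mono) auto

lemma outer_open: "open U \<Longrightarrow> outer U = inner U"
  unfolding outer_def by (rule antisym) (auto intro!: INF_lower INF_greatest inner_mono)

lemma outer_le_inner: "open U \<Longrightarrow> A \<subseteq> U \<Longrightarrow> outer A \<le> inner U"
  unfolding outer_def by (rule INF_lower) simp

lemma outer_le_1: "outer A \<le> 1"
  using outer_le_inner[of UNIV A] inner_le_1[of UNIV] by (auto intro: order_trans)

lemma outer_approx:
  assumes "e > 0"
  shows "\<exists>U. open U \<and> A \<subseteq> U \<and> inner U \<le> outer A + e"
proof -
  have "outer A < top" using outer_le_1[of A] ennreal_one_less_top by (rule le_less_trans)
  then have "outer A < outer A + e"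
    using assms ennreal_add_left_cancel_less[of "outer A" 0 e] by auto
  then have "\<exists>U\<in>{U. open U \<and> A \<subseteq> U}. inner U < outer A + e"
    by (subst (asm) outer_def) (simp only: INF_less_iff)
  then show ?thesis by (blast intro: less_imp_le)
qed

lemma outer_subadditive: "outer (\<Union>n::nat. A n) \<le> (\<Sum>n. outer (A n))"
proof (rule ennreal_le_epsilon)
  fix e :: real assume e: "e > 0"
  have "\<exists>U. open U \<and> A n \<subseteq> U \<and> inner U \<le> outer (A n) + ennreal (e * (1/2)^Suc n)" for n
    by (rule outer_approx) (use e in simp)
  then obtain U where U: "\<And>n. open (U n)" "\<And>n. A n \<subseteq> U n"
    "\<And>n. inner (U n) \<le> outer (A n) + ennreal (e * (1/2)^Suc n)" by metis
  have "outer (\<Union>n. A n) \<le> inner (\<Union>n. U n)"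
    by (rule outer_le_inner) (use U in auto)
  also have "\<dots> \<le> (\<Sum>n. inner (U n))" by (rule inner_UN) (rule U)
  also have "\<dots> \<le> (\<Sum>n. outer (A n) + ennreal (e * (1/2)^Suc n))" by (rule suminf_le[OF U(3)]) auto
  also have "\<dots> = (\<Sum>n. outer (A n)) + (\<Sum>n. ennreal (e * (1/2)^Suc n))" by (rule suminf_add[symmetric]) auto
  also have "(\<Sum>n. ennreal (e * (1/2)^Suc n)) = ennreal e"
    by (rule suminf_ennreal_eq) (use e sums_mult[OF power_half_series, of e] in auto)
  finally show "outer (\<Union>n. A n) \<le> (\<Sum>n. outer (A n)) + ennreal e" .
qed

lemma outer_empty: "outer {} = 0"
  using outer_open[of "{}"] inner_leI[of "{}" 0] empty by auto

lemma outer_space: "outer_measure_space UNIV outer"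
  unfolding outer_measure_space_def positive_def increasing_def countably_subadditive_def
  using outer_mono outer_subadditive outer_empty by auto

text \<open>
  Exhaust \<open>V \<inter> U\<close> by a compact set \<open>C\<close>, then the open set \<open>V - C\<close>, which contains \<open>V - U\<close>, by a
  compact set \<open>D\<close>: the content is additive on \<open>C \<union> D\<close>.
\<close>

lemma inner_split:
  assumes "open U" "open V"
  shows "inner (V \<inter> U) + outer (V - U) \<le> inner V"
proof -
  have "\<Lambda> C + outer (V - U) \<le> inner V" if C: "compact C" "C \<subseteq> V \<inter> U" for C
  proof -
    have "open (V - C)" using C assms closed_compact by (simp add: open_Diff)
    then have "\<Lambda> C + outer (V - U) \<le> \<Lambda> C + inner (V - C)"
      by (intro add_left_mono outer_le_inner) (use C in auto)
    also have "\<dots> = (SUP D \<in> {D. compact D \<and> D \<subseteq> V - C}. \<Lambda> C + \<Lambda> D)"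
      unfolding inner_def by (rule ennreal_SUP_add_right) auto
    also have "\<dots> \<le> inner V"
    proof (rule SUP_least, safe)
      fix D assume D: "compact D" "D \<subseteq> V - C"
      then have "C \<inter> D = {}" by blast
      then have "\<Lambda> C + \<Lambda> D = \<Lambda> (C \<union> D)" using additive[OF C(1) D(1)] by simp
      also have "\<dots> \<le> inner V" by (rule le_inner) (use C D in \<open>auto intro: compact_Un\<close>)
      finally show "\<Lambda> C + \<Lambda> D \<le> inner V" .
    qed
    finally show ?thesis .
  qed
  then show ?thesis
    unfolding inner_def[of "V \<inter> U"]
    by (subst ennreal_SUP_add_left[symmetric]) (auto intro!: SUP_least)
qed

lemma open_outer_measurable:
  assumes "open U"
  shows "U \<in> lambda_system UNIV UNIV outer"
proof -
  have "outer (U \<inter> X) + outer (- U \<inter> X) = outer X" for X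
  proof (rule antisym)
    have "U \<inter> X \<union> (- U \<inter> X) = X" by auto
    then show "outer X \<le> outer (U \<inter> X) + outer (- U \<inter> X)"
      using outer_subadditive[of "binaryset (U \<inter> X) (- U \<inter> X)"] outer_empty
      by (simp add: UN_binaryset_eq suminf_binaryset_eq)
    show "outer (U \<inter> X) + outer (- U \<inter> X) \<le> outer X"
      unfolding outer_def[of X]
    proof (rule INF_greatest, safe)
      fix V assume V: "open V" "X \<subseteq> V"
      have "outer (U \<inter> X) + outer (- U \<inter> X) \<le> inner (V \<inter> U) + outer (V - U)"
        by (intro add_mono outer_le_inner outer_mono) (use V assms in auto)
      also have "\<dots> \<le> inner V" by (rule inner_split) (use V assms in auto)
      finally show "outer (U \<inter> X) + outer (- U \<inter> X) \<le> inner V" .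
    qed
  qed
  then show ?thesis by (auto simp: lambda_system_def Compl_eq_Diff_UNIV)
qed

lemma sets_radon [simp]: "sets radon = sets borel"
  unfolding radon_def using sets.sigma_sets_eq[of "borel :: 'a measure"]
  by (simp add: sets_measure_of)

lemma space_radon [simp]: "space radon = UNIV"
  using sets_eq_imp_space_eq[OF sets_radon] by simp

lemma emeasure_radon:
  assumes "A \<in> sets borel"
  shows "emeasure radon A = outer A"
proof -
  interpret U: sigma_algebra UNIV "UNIV :: 'a set set"
    using sigma_algebra_Pow[of "UNIV :: 'a set"] by simp
  have ms: "measure_space UNIV (lambda_system UNIV UNIV outer) outer"
    by (rule U.caratheodory_lemma[OF outer_space])
  then interpret L: sigma_algebra UNIV "lambda_system UNIV UNIV outer"
    by (simp add: measure_space_def)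
  have "sets borel \<subseteq> lambda_system UNIV UNIV outer"
    unfolding borel_def by (simp, rule L.sigma_sets_subset) (auto intro: open_outer_measurable)
  then have "measure_space UNIV (sets (borel :: 'a measure)) outer"
    using measure_down[OF ms] sets.sigma_algebra_axioms[of "borel :: 'a measure"] by simp
  then show ?thesis
    using assms unfolding radon_def measure_space_def
    by (intro emeasure_measure_of_sigma) auto
qed

lemma emeasure_radon_open: "open U \<Longrightarrow> emeasure radon U = inner U"
  by (simp add: emeasure_radon outer_open)

lemma prob_space_radon: "prob_space radon"
proof
  have "inner UNIV = 1"
    using inner_le_1[of UNIV] le_inner[OF compact_space, of UNIV] total by auto
  then show "emeasure radon (space radon) = 1" by (simp add: emeasure_radon_open)
qed

lemma regular_radon: "regular_measure radon"
  unfolding regular_measure_def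
proof (intro ballI conjI)
  interpret prob_space radon by (rule prob_space_radon)
  have out: "emeasure radon A = (INF U\<in>{U. open U \<and> A \<subseteq> U}. emeasure radon U)" if "A \<in> sets radon" for A
  proof -
    have "emeasure radon A = (INF U\<in>{U. open U \<and> A \<subseteq> U}. inner U)"
      using that by (simp add: emeasure_radon outer_def[of A])
    also have "\<dots> = (INF U\<in>{U. open U \<and> A \<subseteq> U}. emeasure radon U)"
      by (rule INF_cong) (auto simp: emeasure_radon_open)
    finally show ?thesis .
  qed
  fix A assume A: "A \<in> sets radon"
  show "emeasure radon A = (INF U\<in>{U. open U \<and> A \<subseteq> U}. emeasure radon U)" by (rule out[OF A])
  show "emeasure radon A = (SUP C\<in>{C. compact C \<and> C \<subseteq> A}. emeasure radon C)"
  proof (rule antisym)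
    show "(SUP C\<in>{C. compact C \<and> C \<subseteq> A}. emeasure radon C) \<le> emeasure radon A"
      by (rule SUP_least) (use A in \<open>auto intro: emeasure_mono\<close>)
    \<comment> \<open>Inner regularity of \<open>A\<close> is outer regularity of \<open>- A\<close>, since complements of open sets are compact.\<close>
    have Ac: "- A \<in> sets borel" using A by auto
    show "emeasure radon A \<le> (SUP C\<in>{C. compact C \<and> C \<subseteq> A}. emeasure radon C)"
    proof (rule ennreal_le_epsilon)
      fix e :: real assume "e > 0"
      then have "\<exists>U. open U \<and> - A \<subseteq> U \<and> inner U \<le> outer (- A) + ennreal e"
        by (intro outer_approx) simp
      then obtain U where U: "open U" "- A \<subseteq> U" "inner U \<le> outer (- A) + ennreal e" by blast
      have B: "- U \<in> sets borel" "U \<in> sets borel" using U by auto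
      have "prob U \<le> prob (- A) + e"
        using U(3) \<open>e > 0\<close> unfolding emeasure_radon_open[OF U(1), symmetric] emeasure_radon[OF Ac, symmetric]
        by (simp add: emeasure_eq_measure ennreal_plus[symmetric] del: ennreal_plus)
      then have "prob A \<le> prob (- U) + e"
        using prob_compl[of U] prob_compl[of A] A B by (simp add: Compl_eq_Diff_UNIV)
      then have "emeasure radon A \<le> emeasure radon (- U) + e"
        using \<open>e > 0\<close> by (simp add: emeasure_eq_measure ennreal_plus[symmetric] del: ennreal_plus)
      also have "\<dots> \<le> (SUP C\<in>{C. compact C \<and> C \<subseteq> A}. emeasure radon C) + e"
        by (intro add_right_mono SUP_upper) (use U closed_compact[of "- U"] in auto)
      finally show "emeasure radon A \<le> (SUP C\<in>{C. compact C \<and> C \<subseteq> A}. emeasure radon C) + e" .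
    qed
  qed
qed

lemma radon_in_prob_measures: "radon \<in> prob_measures"
  unfolding prob_measures_def using prob_space_radon regular_radon by simp

end

section \<open>Fibrewise isometries\<close>

text \<open>
  The pseudometrics are taken to be restrictions of continuous functions on the whole square,
  although they are meaningful only for pairs in a common fibre. Closure under addition makes
  the family directed and lets \<open>d\<close> be replaced by any of its multiples, so that balls of radius 1
  serve as balls of arbitrarily small radius.
\<close>

locale fibre_metrics =
  fixes q :: "'k::t2_space \<Rightarrow> 'l::t2_space" and D :: "('k \<Rightarrow> 'k \<Rightarrow> real) set"
  assumes compact_K: "compact (UNIV :: 'k set)"
    and q_continuous: "continuous_on UNIV q" and q_surj: "surj q"
    and q_open: "open U \<Longrightarrow> open (q ` U)"
    and D_nonempty: "D \<noteq> {}"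
    and D_add: "d \<in> D \<Longrightarrow> e \<in> D \<Longrightarrow> (\<lambda>x y. d x y + e x y) \<in> D"
    and D_continuous: "d \<in> D \<Longrightarrow> continuous_on UNIV (\<lambda>(x, y). d x y)"
    and nonneg: "d \<in> D \<Longrightarrow> q x = q y \<Longrightarrow> 0 \<le> d x y"
    and refl: "d \<in> D \<Longrightarrow> d x x = 0"
    and sym: "d \<in> D \<Longrightarrow> q x = q y \<Longrightarrow> d x y = d y x"
    and triangle: "d \<in> D \<Longrightarrow> q x = q y \<Longrightarrow> q y = q z \<Longrightarrow> d x z \<le> d x y + d y z"
    and separates: "q x = q y \<Longrightarrow> x \<noteq> y \<Longrightarrow> \<exists>d\<in>D. 1 < d x y"
begin

lemmas closed_compact = closed_iff_compact[OF compact_K]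

lemma D_cont [continuous_intros]:
  assumes "d \<in> D" "continuous_on S f" "continuous_on S g"
  shows "continuous_on S (\<lambda>x. d (f x) (g x))"
  using continuous_on_compose2[OF D_continuous[OF assms(1)] continuous_on_Pair[OF assms(2,3)]] by simp

lemma q_cont [continuous_intros]:
  "continuous_on S f \<Longrightarrow> continuous_on S (\<lambda>x. q (f x))"
  using continuous_on_compose2[OF q_continuous] by auto

lemma closed_fibre: "closed {x. q x = l}"
  by (intro closed_Collect_eq continuous_intros)

lemma compact_fibre: "compact {x. q x = l}"
  using closed_fibre closed_compact by blast

lemma fibre_nonempty: "\<exists>x. q x = l"
  using q_surj by (metis surjD)

lemma D_upper:
  assumes "finite F" "F \<subseteq> D"
  shows "\<exists>e\<in>D. \<forall>d\<in>F. \<forall>x y. q x = q y \<longrightarrow> d x y \<le> e x y"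
  using assms
proof (induction F)
  case empty
  then show ?case using D_nonempty by auto
next
  case (insert d F)
  then obtain e where e: "e \<in> D" "\<forall>d\<in>F. \<forall>x y. q x = q y \<longrightarrow> d x y \<le> e x y" by auto
  have "d \<in> D" using insert by auto
  show ?case
  proof (rule bexI[OF _ D_add[OF \<open>d \<in> D\<close> e(1)]], intro ballI allI impI)
    fix d' x y assume "d' \<in> insert d F" "q x = q y"
    then show "d' x y \<le> d x y + e x y"
      using e(2) nonneg[OF \<open>d \<in> D\<close> \<open>q x = q y\<close>] nonneg[OF e(1) \<open>q x = q y\<close>] by fastforce
  qed
qed

text \<open>
  The sets \<open>{d < 1}\<close> form a base of the uniformity of the fibres, uniformly in the fibre: on the
  compact set of pairs in a common fibre outside \<open>W\<close>, finitely many pseudometrics suffice to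
  exceed 1, and their sum works.
\<close>

lemma entourage:
  assumes "open W" "\<And>x. (x, x) \<in> W"
  shows "\<exists>d\<in>D. \<forall>x y. q x = q y \<longrightarrow> d x y < 1 \<longrightarrow> (x, y) \<in> W"
proof -
  let ?C = "{z. q (fst z) = q (snd z)} - W"
  have "compact (UNIV \<inter> ?C)"
    by (intro compact_Int_closed compact_UNIV_Times compact_K closed_Diff assms closed_Collect_eq continuous_intros)
  then have "compact ?C" by simp
  moreover have "?C \<subseteq> (\<Union>d\<in>D. {z. 1 < d (fst z) (snd z)})"
    using separates assms(2) by (auto) metis
  moreover have "open {z. 1 < d (fst z) (snd z)}" if "d \<in> D" for d
    by (intro open_Collect_less continuous_intros that)
  ultimately obtain F where F: "F \<subseteq> D" "finite F" "?C \<subseteq> (\<Union>d\<in>F. {z. 1 < d (fst z) (snd z)})"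
    by (metis (no_types, lifting) compactE_image)
  obtain e where e: "e \<in> D" "\<forall>d\<in>F. \<forall>x y. q x = q y \<longrightarrow> d x y \<le> e x y"
    using D_upper[OF F(2,1)] by blast
  show ?thesis
  proof (rule bexI[OF _ e(1)], intro allI impI, rule ccontr)
    fix x y assume xy: "q x = q y" "e x y < 1" "(x, y) \<notin> W"
    then have "(x, y) \<in> ?C" by simp
    then obtain d where "d \<in> F" "1 < d x y" using F(3) by fastforce
    with e(2) xy show False by fastforce
  qed
qed

lemma ball_open: "d \<in> D \<Longrightarrow> open {y. d x y < r}"
  by (intro open_Collect_less continuous_intros)

lemma fibre_nhd:
  assumes "open V" "x \<in> V"
  shows "\<exists>d\<in>D. \<forall>y. q y = q x \<longrightarrow> d x y < 1 \<longrightarrow> y \<in> V"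
proof -
  have "open (- ({x} \<times> (- V)))" using assms by (intro open_Compl closed_Times) auto
  with entourage[of "- ({x} \<times> (- V))"] assms show ?thesis by (auto) metis
qed

lemma separate_closed:
  assumes "closed A" "closed B" "A \<inter> B = {}"
  shows "\<exists>d\<in>D. \<forall>x\<in>A. \<forall>y\<in>B. q x = q y \<longrightarrow> 1 \<le> d x y"
proof -
  have "open (- (A \<times> B))" using assms by (intro open_Compl closed_Times) auto
  with entourage[of "- (A \<times> B)"] assms obtain d where
    "d \<in> D" "\<forall>x y. q x = q y \<longrightarrow> d x y < 1 \<longrightarrow> (x, y) \<notin> A \<times> B" by auto
  then show ?thesis by (intro bexI[of _ d]) (auto simp: not_less[symmetric])
qed

definition covers :: "('k \<Rightarrow> 'k \<Rightarrow> real) \<Rightarrow> 'k set \<Rightarrow> 'k set \<Rightarrow> bool" where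
  "covers d F A \<longleftrightarrow> finite F \<and> (\<forall>y\<in>A. \<exists>x\<in>F. q x = q y \<and> d x y < 1)"

lemma fibre_totally_bounded:
  assumes "d \<in> D"
  shows "\<exists>F. F \<subseteq> {x. q x = l} \<and> covers d F {x. q x = l}"
proof -
  have "{x. q x = l} \<subseteq> (\<Union>x\<in>{x. q x = l}. {y. d x y < 1})"
    using refl[OF assms] by auto
  then obtain F where "F \<subseteq> {x. q x = l}" "finite F" "{x. q x = l} \<subseteq> (\<Union>x\<in>F. {y. d x y < 1})"
    using compactE_image[OF compact_fibre, of "{x. q x = l}" "\<lambda>x. {y. d x y < 1}" l] ball_open[OF assms] by metis
  then show ?thesis unfolding covers_def by (intro exI[of _ F]) (auto, blast)
qed

text \<open>
  Isometric maps between fibres, represented by total functions. All their values are required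
  to lie in the target fibre, also those at arguments outside the source fibre, so that the
  isometries out of a fixed fibre form a closed set of functions on which the target fibre can
  be read off at any argument.
\<close>

definition isos :: "'l \<Rightarrow> 'l \<Rightarrow> ('k \<Rightarrow> 'k) set" where
  "isos l m = {z. (\<forall>s. q (z s) = m) \<and>
     (\<forall>d\<in>D. \<forall>s t. q s = l \<longrightarrow> q t = l \<longrightarrow> d (z s) (z t) = d s t)}"

lemma isos_fibre: "z \<in> isos l m \<Longrightarrow> q (z s) = m"
  unfolding isos_def by blast

lemma isos_dist: "z \<in> isos l m \<Longrightarrow> d \<in> D \<Longrightarrow> q s = l \<Longrightarrow> q t = l \<Longrightarrow> d (z s) (z t) = d s t"
  unfolding isos_def by blast

lemma isos_comp: "w \<in> isos l m \<Longrightarrow> z \<in> isos m n \<Longrightarrow> z \<circ> w \<in> isos l n"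
  unfolding isos_def by auto

lemma isos_inj:
  assumes "z \<in> isos l m"
  shows "inj_on z {x. q x = l}"
proof (rule inj_onI, rule ccontr)
  fix x y assume *: "x \<in> {x. q x = l}" "y \<in> {x. q x = l}" "z x = z y" "x \<noteq> y"
  then obtain d where d: "d \<in> D" "1 < d x y" using separates[of x y] by auto
  then show False using isos_dist[OF assms d(1), of x y] refl[OF d(1)] * by auto
qed

lemma isos_continuous:
  assumes z: "z \<in> isos l m"
  shows "continuous_on {x. q x = l} z"
  unfolding continuous_on_topological
proof (intro ballI allI impI)
  fix x B assume x: "x \<in> {x. q x = l}" and B: "open B" "z x \<in> B"
  obtain d where d: "d \<in> D" "\<forall>y. q y = q (z x) \<longrightarrow> d (z x) y < 1 \<longrightarrow> y \<in> B"
    using fibre_nhd[OF B] by blast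
  show "\<exists>A. open A \<and> x \<in> A \<and> (\<forall>y\<in>{x. q x = l}. y \<in> A \<longrightarrow> z y \<in> B)"
    by (rule exI[of _ "{y. d x y < 1}"])
       (use x d ball_open isos_dist[OF z d(1)] isos_fibre[OF z] refl[OF d(1), of x] in auto)
qed

text \<open>
  If \<open>y\<close> were missed, some \<open>d\<close> would keep \<open>y\<close> at distance 1 from the compact image, and then the
  iterates of \<open>y\<close> would be pairwise at distance at least 1, contradicting total boundedness.
\<close>

lemma iso_self_surj:
  assumes \<sigma>: "\<sigma> \<in> isos l l"
  shows "{x. q x = l} \<subseteq> \<sigma> ` {x. q x = l}"
proof (rule subsetI, rule ccontr)
  fix y assume y: "y \<in> {x. q x = l}" "y \<notin> \<sigma> ` {x. q x = l}"
  have "compact (\<sigma> ` {x. q x = l})"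
    by (rule compact_continuous_image[OF isos_continuous[OF \<sigma>] compact_fibre])
  then have "\<exists>d\<in>D. \<forall>x\<in>{y}. \<forall>y\<in>\<sigma> ` {x. q x = l}. q x = q y \<longrightarrow> 1 \<le> d x y"
    by (intro separate_closed) (use y in \<open>auto simp: compact_imp_closed\<close>)
  then obtain d where d: "d \<in> D" "\<And>x. q x = l \<Longrightarrow> 1 \<le> d y (\<sigma> x)"
    using y isos_fibre[OF \<sigma>] by auto
  have it: "(\<sigma> ^^ n) y \<in> {x. q x = l}" for n
    by (induction n) (use y isos_fibre[OF \<sigma>] in auto)
  have shift: "d ((\<sigma> ^^ i) y) ((\<sigma> ^^ (i + n)) y) = d y ((\<sigma> ^^ n) y)" for i n
    by (induction i) (use isos_dist[OF \<sigma> d(1)] it in auto)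
  have far: "1 \<le> d ((\<sigma> ^^ i) y) ((\<sigma> ^^ j) y)" if "i < j" for i j
  proof -
    obtain n where "j = i + Suc n" using \<open>i < j\<close> less_imp_Suc_add by auto
    then show ?thesis using shift[of i "Suc n"] d(2)[of "(\<sigma> ^^ n) y"] it[of n] by simp
  qed
  \<comment> \<open>Two points in one ball of \<open>e\<close>-radius 1 have \<open>d\<close>-distance less than 1.\<close>
  define e where "e = (\<lambda>x y. d x y + d x y)"
  have e: "e \<in> D" unfolding e_def using d D_add by blast
  obtain F where F: "F \<subseteq> {x. q x = l}" "covers e F {x. q x = l}"
    using fibre_totally_bounded[OF e] by blast
  have "\<exists>x\<in>F. e x ((\<sigma> ^^ n) y) < 1" for n
    using F(2) it[of n] unfolding covers_def by blast
  then obtain c where c: "\<And>n. c n \<in> F" "\<And>n. e (c n) ((\<sigma> ^^ n) y) < 1" by metis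
  have "finite F" using F(2) unfolding covers_def by simp
  then have "\<not> inj c"
    using c(1) by (metis finite_subset image_subsetI infinite_UNIV_nat finite_imageD)
  then obtain i j where ij: "i < j" "c i = c j"
    unfolding inj_def by (metis linorder_neqE_nat)
  have f: "q (c i) = l" "q ((\<sigma> ^^ i) y) = l" "q ((\<sigma> ^^ j) y) = l" using c(1) F(1) it by auto
  have "d ((\<sigma> ^^ i) y) ((\<sigma> ^^ j) y) \<le> d ((\<sigma> ^^ i) y) (c i) + d (c i) ((\<sigma> ^^ j) y)"
    by (rule triangle[OF d(1)]) (use f in auto)
  then show False
    using far[OF ij(1)] c(2)[of i] c(2)[of j] ij(2) sym[OF d(1), of "(\<sigma> ^^ i) y" "c i"] f
    unfolding e_def by auto
qed

lemma isos_surj: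
  assumes z: "z \<in> isos l m" and w: "w \<in> isos m l"
  shows "z ` {x. q x = l} = {x. q x = m}"
proof
  show "z ` {x. q x = l} \<subseteq> {x. q x = m}" using isos_fibre[OF z] by auto
  have "{x. q x = m} \<subseteq> (z \<circ> w) ` {x. q x = m}" by (rule iso_self_surj[OF isos_comp[OF w z]])
  also have "\<dots> \<subseteq> z ` {x. q x = l}" using isos_fibre[OF w] by auto
  finally show "{x. q x = m} \<subseteq> z ` {x. q x = l}" .
qed

definition fibre_maps :: "'l \<Rightarrow> ('k \<Rightarrow> 'k) set" where
  "fibre_maps m = {z. \<forall>s. q (z s) = m}"

lemma coord_continuous: "continuous_on S (\<lambda>z :: 'k \<Rightarrow> 'k. z s)"
  using continuous_on_product_coordinates[of s] continuous_on_subset by blast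

lemma compact_fibre_maps: "compact (fibre_maps m)"
proof -
  have "closed (\<Inter>s. {z :: 'k \<Rightarrow> 'k. q (z s) = m})"
    by (intro closed_INT ballI closed_Collect_eq continuous_intros coord_continuous)
  then have "compact (UNIV \<inter> (\<Inter>s. {z :: 'k \<Rightarrow> 'k. q (z s) = m}))"
    by (intro compact_Int_closed compact_UNIV_fun compact_K)
  moreover have "UNIV \<inter> (\<Inter>s. {z. q (z s) = m}) = fibre_maps m"
    unfolding fibre_maps_def by auto
  ultimately show ?thesis by simp
qed

lemma fibre_maps_nonempty: "fibre_maps m \<noteq> {}"
  using fibre_nonempty[of m] unfolding fibre_maps_def by auto

text \<open>
  A minimum over all configurations of points in the fibre depends continuously on the fibre.
  A configuration that beats \<open>r\<close> can be moved to nearby fibres because \<open>q\<close> is open and a basic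
  neighbourhood constrains finitely many points only. Conversely, the fibres where \<open>r\<close> is
  attained form the image of a compact set.
\<close>

lemma continuous_fibre_Inf:
  fixes h :: "('k \<Rightarrow> 'k) \<Rightarrow> real"
  assumes h: "continuous_on UNIV h"
  shows "\<exists>z\<in>fibre_maps m. h z = Inf (h ` fibre_maps m)" (is ?att)
    and "continuous_on UNIV (\<lambda>m. Inf (h ` fibre_maps m))" (is ?cont)
proof -
  let ?\<Phi> = "\<lambda>m. Inf (h ` fibre_maps m)"
  have min: "\<exists>z\<in>fibre_maps m. h z = ?\<Phi> m \<and> (\<forall>z'\<in>fibre_maps m. ?\<Phi> m \<le> h z')" for m
  proof -
    obtain z where z: "z \<in> fibre_maps m" "\<forall>z'\<in>fibre_maps m. h z \<le> h z'"
      using continuous_attains_inf[OF compact_fibre_maps fibre_maps_nonempty continuous_on_subset[OF h]] by blast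
    then have "h z = ?\<Phi> m" by (intro cInf_eq_minimum[symmetric]) auto
    with z show ?thesis by auto
  qed
  then show ?att by blast
  have lt: "open {m. ?\<Phi> m < r}" for r
  proof (subst open_subopen, intro ballI)
    fix m assume "m \<in> {m. ?\<Phi> m < r}"
    then obtain z where z: "z \<in> fibre_maps m" "h z < r" using min[of m] by auto
    have "open {z. h z < r}" by (intro open_Collect_less h continuous_intros)
    then have "openin (product_topology (\<lambda>_. euclidean) UNIV) {z. h z < r}"
      by (simp add: open_fun_def)
    then obtain X where X: "z \<in> PiE UNIV X" "\<And>s. open (X s)" "finite {s. X s \<noteq> UNIV}"
      "PiE UNIV X \<subseteq> {z. h z < r}"
      using product_topology_open_contains_basis[of "\<lambda>_. euclidean" UNIV "{z. h z < r}" z] z(2) by auto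
    let ?V = "\<Inter>s\<in>{s. X s \<noteq> UNIV}. q ` X s"
    have "open ?V" using X(2,3) q_open by (intro open_INT) auto
    moreover have "m \<in> ?V" using X(1) z(1) unfolding fibre_maps_def by (fastforce simp: PiE_UNIV_domain)
    moreover have "?V \<subseteq> {m. ?\<Phi> m < r}"
    proof safe
      fix m' assume m': "m' \<in> ?V"
      have "\<exists>x\<in>X s. q x = m'" for s
      proof (cases "X s = UNIV")
        case True
        then show ?thesis using fibre_nonempty[of m'] by auto
      next
        case False
        then have "m' \<in> q ` X s" using m' by auto
        then show ?thesis by auto
      qed
      then obtain z' where z': "\<And>s. z' s \<in> X s" "\<And>s. q (z' s) = m'" by metis
      then have "h z' < r" "z' \<in> fibre_maps m'"
        using X(4) unfolding fibre_maps_def by (auto simp: PiE_UNIV_domain)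
      then show "?\<Phi> m' < r" using min[of m'] by fastforce
    qed
    ultimately show "\<exists>T. open T \<and> m \<in> T \<and> T \<subseteq> {m. ?\<Phi> m < r}" by blast
  qed
  have gt: "open {m. r < ?\<Phi> m}" for r
  proof -
    let ?Z = "(\<Inter>s. {z. q (z s) = q (z undefined)}) \<inter> {z. h z \<le> r}"
    have "compact (UNIV \<inter> ?Z)"
      by (intro compact_Int_closed compact_UNIV_fun compact_K closed_Int closed_INT ballI
           closed_Collect_eq closed_Collect_le h continuous_intros coord_continuous)
    then have "compact ((\<lambda>z. q (z undefined)) ` ?Z)"
      by (intro compact_continuous_image continuous_intros coord_continuous) simp
    then have "closed ((\<lambda>z. q (z undefined)) ` ?Z)" by (rule compact_imp_closed)
    moreover have "(\<lambda>z. q (z undefined)) ` ?Z = {m. ?\<Phi> m \<le> r}"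
    proof safe
      fix z assume "z \<in> (\<Inter>s. {z. q (z s) = q (z undefined)})" "h z \<le> r"
      moreover from this have "z \<in> fibre_maps (q (z undefined))" by (auto simp: fibre_maps_def)
      ultimately show "?\<Phi> (q (z undefined)) \<le> r" using min[of "q (z undefined)"] by fastforce
    next
      fix m assume "?\<Phi> m \<le> r"
      then obtain z where "z \<in> fibre_maps m" "h z \<le> r" using min[of m] by auto
      then show "m \<in> (\<lambda>z. q (z undefined)) ` ?Z"
        by (intro image_eqI[of _ _ z]) (auto simp: fibre_maps_def)
    qed
    ultimately have "closed {m. ?\<Phi> m \<le> r}" by simp
    then have "open (- {m. ?\<Phi> m \<le> r})" by (rule open_Compl)
    then show ?thesis by (simp add: Compl_eq not_le)
  qed
  show ?cont
    unfolding continuous_on_def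
  proof (intro ballI order_tendstoI)
    fix m a assume "a < ?\<Phi> m"
    then show "\<forall>\<^sub>F m' in at m within UNIV. a < ?\<Phi> m'"
      using gt[of a] by (auto simp: eventually_at_topological)
  next
    fix m a assume "?\<Phi> m < a"
    then show "\<forall>\<^sub>F m' in at m within UNIV. ?\<Phi> m' < a"
      using lt[of a] by (auto simp: eventually_at_topological)
  qed
qed

end

locale isometric_action = fibre_metrics q D
  for q :: "'k::t2_space \<Rightarrow> 'l::t2_space" and D +
  fixes \<phi> :: "'g::group_add \<Rightarrow> 'k \<Rightarrow> 'k" and \<psi> :: "'g \<Rightarrow> 'l \<Rightarrow> 'l"
  assumes \<phi>_continuous: "continuous_on UNIV (\<phi> g)"
    and \<phi>_zero: "\<phi> 0 x = x" and \<phi>_add: "\<phi> (g + h) x = \<phi> g (\<phi> h x)"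
    and \<psi>_zero: "\<psi> 0 l = l" and \<psi>_add: "\<psi> (g + h) l = \<psi> g (\<psi> h l)"
    and equivariant: "q (\<phi> g x) = \<psi> g (q x)"
    and isometric: "d \<in> D \<Longrightarrow> q x = q y \<Longrightarrow> d (\<phi> g x) (\<phi> g y) = d x y"
    and \<phi>_ergodic: "continuous_on UNIV f \<Longrightarrow> (\<And>g x. f (\<phi> g x) = f x) \<Longrightarrow> f x = (f y :: real)"
begin

text \<open>
  Ergodicity passes to the factor \<open>L\<close> by pulling functions back along \<open>q\<close>.
\<close>

lemma \<psi>_ergodic:
  fixes f :: "'l \<Rightarrow> real"
  assumes "continuous_on UNIV f" "\<And>g l. f (\<psi> g l) = f l"
  shows "f l = f m"
proof -
  have "continuous_on UNIV (\<lambda>x. f (q x))"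
    by (rule continuous_on_compose2[OF assms(1) q_continuous]) simp
  then have "f (q x) = f (q y)" for x y
    by (rule \<phi>_ergodic) (simp add: equivariant assms(2))
  then show ?thesis using fibre_nonempty by metis
qed

lemma \<phi>_minus: "\<phi> g (\<phi> (- g) x) = x"
  by (metis \<phi>_add \<phi>_zero right_minus)

lemma \<psi>_minus: "\<psi> (- g) (\<psi> g l) = l"
  by (metis \<psi>_add \<psi>_zero left_minus)

lemma fibre_maps_translate: "fibre_maps (\<psi> g m) = (\<lambda>z s. \<phi> g (z s)) ` fibre_maps m"
proof safe
  fix z assume z: "z \<in> fibre_maps (\<psi> g m)"
  then have "q (\<phi> (- g) (z s)) = m" for s
    by (simp add: fibre_maps_def equivariant \<psi>_minus)
  then show "z \<in> (\<lambda>z s. \<phi> g (z s)) ` fibre_maps m"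
    by (intro image_eqI[of _ _ "\<lambda>s. \<phi> (- g) (z s)"]) (auto simp: fibre_maps_def \<phi>_minus)
qed (auto simp: fibre_maps_def equivariant)

text \<open>
  The first use of ergodicity. For finitely many constraints (a pseudometric and two points of
  the fibre over \<open>l\<close>), the least total error with which they can be met in the fibre over \<open>m\<close> is
  a continuous and invariant function of \<open>m\<close>. It is zero at \<open>m = l\<close>, where the identity meets
  all constraints, so it is zero everywhere. By compactness all constraints can be met at once.
\<close>

lemma isos_nonempty: "isos l m \<noteq> {}"
proof -
  let ?I = "D \<times> {x. q x = l} \<times> {x. q x = l}"
  define E where "E i = {z. fst i (z (fst (snd i))) (z (snd (snd i))) = fst i (fst (snd i)) (snd (snd i))}"
    for i :: "('k \<Rightarrow> 'k \<Rightarrow> real) \<times> 'k \<times> 'k"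
  have "fibre_maps m \<inter> (\<Inter>i\<in>?I. E i) \<noteq> {}"
  proof (rule compact_imp_fip_image[OF compact_fibre_maps])
    show "closed (E i)" if "i \<in> ?I" for i
      unfolding E_def by (intro closed_Collect_eq continuous_intros coord_continuous) (use that in auto)
  next
    fix T assume T: "finite T" "T \<subseteq> ?I"
    define h where "h z = (\<Sum>i\<in>T. \<bar>fst i (z (fst (snd i))) (z (snd (snd i))) - fst i (fst (snd i)) (snd (snd i))\<bar>)" for z
    have h: "continuous_on UNIV h"
      unfolding h_def by (intro continuous_intros coord_continuous) (use T in auto)
    have h0: "h z = 0 \<longleftrightarrow> (\<forall>i\<in>T. z \<in> E i)" for z
      unfolding h_def E_def using T(1) by (subst sum_nonneg_eq_0_iff) auto
    have inv: "h (\<lambda>s. \<phi> g (z s)) = h z" if "z \<in> fibre_maps m'" for g z m'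
      unfolding h_def
    proof (intro sum.cong HOL.refl)
      fix i assume "i \<in> T"
      then have "fst i \<in> D" using T by auto
      then show "\<bar>fst i (\<phi> g (z (fst (snd i)))) (\<phi> g (z (snd (snd i)))) - fst i (fst (snd i)) (snd (snd i))\<bar> =
                 \<bar>fst i (z (fst (snd i))) (z (snd (snd i))) - fst i (fst (snd i)) (snd (snd i))\<bar>"
        using isometric[of "fst i" "z (fst (snd i))" "z (snd (snd i))"] that by (auto simp: fibre_maps_def)
    qed
    have "Inf (h ` fibre_maps (\<psi> g m')) = Inf (h ` fibre_maps m')" for g m'
      unfolding fibre_maps_translate image_image using inv by (metis (no_types, lifting) image_cong)
    then have const: "Inf (h ` fibre_maps m) = Inf (h ` fibre_maps l)"
      by (rule \<psi>_ergodic[OF continuous_fibre_Inf(2)[OF h]])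
    obtain s0 where s0: "q s0 = l" using fibre_nonempty by blast
    let ?z0 = "\<lambda>s. if q s = l then s else s0"
    have "?z0 \<in> fibre_maps l" "h ?z0 = 0"
      unfolding h0 using T s0 by (auto simp: fibre_maps_def E_def)
    moreover have "bdd_below (h ` fibre_maps l)"
      by (rule bdd_belowI2[where m=0]) (simp add: h_def sum_nonneg)
    ultimately have "Inf (h ` fibre_maps l) \<le> 0"
      using cINF_lower[of h "fibre_maps l" ?z0] by simp
    then obtain z where z: "z \<in> fibre_maps m" "h z \<le> 0"
      using continuous_fibre_Inf(1)[OF h, of m] const by auto
    moreover have "0 \<le> h z" by (simp add: h_def sum_nonneg)
    ultimately have "h z = 0" by simp
    then show "fibre_maps m \<inter> (\<Inter>i\<in>T. E i) \<noteq> {}" using z h0 by blast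
  qed
  then obtain z where "z \<in> fibre_maps m" "\<And>i. i \<in> ?I \<Longrightarrow> z \<in> E i" by blast
  then have "z \<in> isos l m" unfolding isos_def fibre_maps_def E_def by auto
  then show ?thesis by blast
qed

end

section \<open>Fibre measures from covering numbers\<close>

lemma continuous_imp_integrable:
  fixes f :: "'a::topological_space \<Rightarrow> 'b::{banach, second_countable_topology}"
  assumes "compact (UNIV :: 'a set)" "finite_measure M" "sets M = sets borel" "continuous_on UNIV f"
  shows "integrable M f"
proof -
  interpret finite_measure M by fact
  have "bounded (range f)" using compact_continuous_image[OF assms(4,1)] by (rule compact_imp_bounded)
  then obtain B where "\<And>x. norm (f x) \<le> B" by (auto simp: bounded_iff)
  moreover have "f \<in> borel_measurable M"
    using borel_measurable_continuous_onI[OF assms(4)] assms(3) by (metis measurable_cong_sets)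
  ultimately show ?thesis by (intro integrable_const_bound[where B=B]) auto
qed

lemma (in prob_space) dist_integral_le:
  fixes f g :: "'a \<Rightarrow> 'b::{banach, second_countable_topology}"
  assumes "integrable M f" "integrable M g" "AE x in M. dist (f x) (g x) \<le> c"
  shows "dist (integral\<^sup>L M f) (integral\<^sup>L M g) \<le> c"
proof -
  have "dist (integral\<^sup>L M f) (integral\<^sup>L M g) = norm (\<integral>x. f x - g x \<partial>M)"
    using assms by (simp add: dist_norm)
  also have "\<dots> \<le> (\<integral>x. norm (f x - g x) \<partial>M)" by (rule integral_norm_bound)
  also have "\<dots> \<le> (\<integral>x. c \<partial>M)"
    by (rule integral_mono_AE) (use assms in \<open>auto simp: dist_norm\<close>)
  also have "\<dots> = c" by (simp add: prob_space)
  finally show ?thesis .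
qed

context fibre_metrics
begin

text \<open>
  Covering numbers of subsets of a fibre by \<open>d\<close>-balls of radius 1. Their asymptotic behaviour
  defines the analogue of Haar measure on a fibre.
\<close>

definition cov :: "('k \<Rightarrow> 'k \<Rightarrow> real) \<Rightarrow> 'k set \<Rightarrow> nat" where
  "cov d A = (LEAST n. \<exists>F. covers d F A \<and> card F = n)"

lemma cov_le: "covers d F A \<Longrightarrow> cov d A \<le> card F"
  unfolding cov_def by (rule Least_le) blast

lemma covers_mono: "covers d F B \<Longrightarrow> A \<subseteq> B \<Longrightarrow> covers d F A"
  unfolding covers_def by blast

lemma cov_attained:
  assumes "d \<in> D" "A \<subseteq> {x. q x = l}"
  obtains F where "covers d F A" "card F = cov d A"
proof -
  have "\<exists>n F. covers d F A \<and> card F = n"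
    using fibre_totally_bounded[OF assms(1)] covers_mono[OF _ assms(2)] by metis
  from LeastI_ex[OF this] that show thesis unfolding cov_def by blast
qed

lemma cov_mono:
  assumes "d \<in> D" "A \<subseteq> B" "B \<subseteq> {x. q x = l}"
  shows "cov d A \<le> cov d B"
  using cov_attained[OF assms(1,3)] covers_mono[OF _ assms(2)] cov_le by metis

lemma cov_empty: "cov d {} = 0"
  using cov_le[of d "{}" "{}"] by (simp add: covers_def)

lemma cov_pos:
  assumes "d \<in> D"
  shows "0 < cov d {x. q x = l}"
proof (rule ccontr)
  assume "\<not> 0 < cov d {x. q x = l}"
  then obtain F where "covers d F {x. q x = l}" "card F = 0"
    using cov_attained[OF assms subset_refl] by (metis gr0I)
  then show False using fibre_nonempty[of l] by (auto simp: covers_def)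
qed

lemma cov_Un:
  assumes "d \<in> D" "A \<subseteq> {x. q x = l}" "B \<subseteq> {x. q x = l}"
  shows "cov d (A \<union> B) \<le> cov d A + cov d B"
proof -
  obtain F where F: "covers d F A" "card F = cov d A" by (rule cov_attained[OF assms(1,2)])
  obtain G where G: "covers d G B" "card G = cov d B" by (rule cov_attained[OF assms(1,3)])
  have "covers d (F \<union> G) (A \<union> B)" using F G unfolding covers_def by auto
  then have "cov d (A \<union> B) \<le> card (F \<union> G)" by (rule cov_le)
  also have "\<dots> \<le> card F + card G" by (rule card_Un_le)
  finally show ?thesis using F G by simp
qed

text \<open>
  A ball of radius 1 cannot meet two sets at distance at least 2.
\<close>

lemma cov_Un_separated:
  assumes d: "d \<in> D" and A: "A \<subseteq> {x. q x = l}" and B: "B \<subseteq> {x. q x = l}"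
    and sep: "\<And>x y. x \<in> A \<Longrightarrow> y \<in> B \<Longrightarrow> 2 \<le> d x y"
  shows "cov d (A \<union> B) = cov d A + cov d B"
proof (rule antisym)
  show "cov d (A \<union> B) \<le> cov d A + cov d B" by (rule cov_Un[OF d A B])
  have AB: "A \<union> B \<subseteq> {x. q x = l}" using A B by auto
  obtain F where F: "covers d F (A \<union> B)" "card F = cov d (A \<union> B)" by (rule cov_attained[OF d AB])
  define near where "near S = {c \<in> F. \<exists>y\<in>S. q c = q y \<and> d c y < 1}" for S
  have fin: "finite F" using F unfolding covers_def by auto
  have "covers d (near S) S" if S: "S \<subseteq> A \<union> B" for S
    unfolding covers_def
  proof (intro conjI ballI)
    show "finite (near S)" using fin by (simp add: near_def)
    fix y assume "y \<in> S"
    moreover have "\<forall>y\<in>A \<union> B. \<exists>x\<in>F. q x = q y \<and> d x y < 1" using F by (simp add: covers_def)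
    ultimately obtain c where "c \<in> F" "q c = q y" "d c y < 1" using S by (meson subsetD)
    with \<open>y \<in> S\<close> show "\<exists>x\<in>near S. q x = q y \<and> d x y < 1" unfolding near_def by blast
  qed
  then have "covers d (near A) A" "covers d (near B) B" by auto
  then have "cov d A + cov d B \<le> card (near A) + card (near B)" by (intro add_mono cov_le)
  also have "\<dots> = card (near A \<union> near B)"
  proof (rule card_Un_disjoint[symmetric])
    show "near A \<inter> near B = {}"
    proof (rule ccontr)
      assume "near A \<inter> near B \<noteq> {}"
      then obtain c x y where c: "x \<in> A" "q c = q x" "d c x < 1" "y \<in> B" "q c = q y" "d c y < 1"
        unfolding near_def by auto
      then show False
        using sep[of x y] triangle[OF d, of x c y] sym[OF d, of c x] by auto
    qed
  qed (use fin in \<open>auto simp: near_def\<close>)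
  also have "\<dots> \<le> card F" by (rule card_mono[OF fin]) (auto simp: near_def)
  finally show "cov d A + cov d B \<le> cov d (A \<union> B)" using F by simp
qed

lemma cov_image_le:
  assumes d: "d \<in> D" and z: "z \<in> isos l m" and A: "A \<subseteq> {x. q x = l}"
  shows "cov d (z ` A) \<le> cov d A"
proof -
  obtain F where F: "covers d F A" "card F = cov d A" by (rule cov_attained[OF d A])
  have "covers d (z ` (F \<inter> {x. q x = l})) (z ` A)"
    unfolding covers_def
  proof (intro conjI ballI)
    show "finite (z ` (F \<inter> {x. q x = l}))" using F unfolding covers_def by auto
    fix y assume "y \<in> z ` A"
    then obtain x where x: "x \<in> A" "y = z x" by auto
    then obtain c where c: "c \<in> F" "q c = q x" "d c x < 1" using F unfolding covers_def by auto
    have "q x = l" using A x by auto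
    then show "\<exists>x\<in>z ` (F \<inter> {x. q x = l}). q x = q y \<and> d x y < 1"
      using c x isos_dist[OF z d, of c x] isos_fibre[OF z]
      by (intro bexI[of _ "z c"]) auto
  qed
  then have "cov d (z ` A) \<le> card (z ` (F \<inter> {x. q x = l}))" by (rule cov_le)
  also have "\<dots> \<le> card (F \<inter> {x. q x = l})" using F by (intro card_image_le) (auto simp: covers_def)
  also have "\<dots> \<le> card F" using F by (intro card_mono) (auto simp: covers_def)
  finally show ?thesis using F by simp
qed

lemma isos_inverse:
  assumes z: "z \<in> isos l m" and w: "w \<in> isos m l"
  shows "\<exists>v\<in>isos m l. \<forall>s. q s = l \<longrightarrow> v (z s) = s"
proof -
  let ?K = "{x. q x = l}"
  have surj: "z ` ?K = {x. q x = m}" by (rule isos_surj[OF z w])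
  obtain s0 where "q s0 = l" using fibre_nonempty by blast
  define v where "v y = (if q y = m then inv_into ?K z y else s0)" for y
  have 1: "v (z s) = s" if "q s = l" for s
    using inv_into_f_f[OF isos_inj[OF z], of s] isos_fibre[OF z] that by (simp add: v_def)
  have ex: "\<exists>s. q s = l \<and> y = z s" if "q y = m" for y using surj that by blast
  have "v \<in> isos m l"
    unfolding isos_def
  proof (safe)
    fix y show "q (v y) = l"
    proof (cases "q y = m")
      case True
      then obtain s where "q s = l" "y = z s" using ex by blast
      then show ?thesis using 1 by simp
    qed (simp add: v_def \<open>q s0 = l\<close>)
  next
    fix d s t assume "d \<in> D" "m = q s" "q t = q s"
    then show "d (v s) (v t) = d s t"
      using ex[of s] ex[of t] 1 isos_dist[OF z \<open>d \<in> D\<close>] by auto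
  qed
  then show ?thesis using 1 by blast
qed

lemma cov_image:
  assumes d: "d \<in> D" and z: "z \<in> isos l m" and w: "w \<in> isos m l" and A: "A \<subseteq> {x. q x = l}"
  shows "cov d (z ` A) = cov d A"
proof (rule antisym)
  show "cov d (z ` A) \<le> cov d A" by (rule cov_image_le[OF d z A])
  obtain v where v: "v \<in> isos m l" "\<And>s. q s = l \<Longrightarrow> v (z s) = s"
    using isos_inverse[OF z w] by blast
  have "v ` z ` A = A" using v(2) A by (force simp: image_image)
  then show "cov d A \<le> cov d (z ` A)"
    using cov_image_le[OF d v(1), of "z ` A"] isos_fibre[OF z] by auto
qed

definition ratio :: "('k \<Rightarrow> 'k \<Rightarrow> real) \<Rightarrow> 'l \<times> 'k set \<Rightarrow> real" where
  "ratio d = (\<lambda>(l, C). real (cov d (C \<inter> {x. q x = l})) / real (cov d {x. q x = l}))"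

definition finer :: "('k \<Rightarrow> 'k \<Rightarrow> real) \<Rightarrow> ('k \<Rightarrow> 'k \<Rightarrow> real) \<Rightarrow> bool" where
  "finer d e \<longleftrightarrow> (\<forall>x y. q x = q y \<longrightarrow> e x y \<le> d x y)"

text \<open>
  A limit point of the normalized covering numbers along ever finer pseudometrics, stated
  through the closed sets that contain it: a closed condition that holds for all sufficiently
  fine \<open>d\<close> holds in the limit. It is chosen simultaneously for all fibres, so that relations
  between different fibres pass to the limit as well.
\<close>

lemma ratio_limit:
  "\<exists>c. \<forall>S e. closed S \<longrightarrow> e \<in> D \<longrightarrow> (\<forall>d\<in>D. finer d e \<longrightarrow> ratio d \<in> S) \<longrightarrow> c \<in> S"
proof -
  let ?box = "PiE UNIV (\<lambda>_ :: 'l \<times> 'k set. {0..1::real})"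
  have "compactin (product_topology (\<lambda>_. euclidean) UNIV) ?box"
    unfolding compactin_PiE by simp
  then have "compact ?box" by (simp add: euclidean_product_topology)
  moreover have box: "ratio d \<in> ?box" if "d \<in> D" for d
  proof -
    have "ratio d i \<in> {0..1}" for i
      using cov_mono[OF that, of "snd i \<inter> {x. q x = fst i}" "{x. q x = fst i}" "fst i"] cov_pos[OF that, of "fst i"]
      by (simp add: ratio_def split_beta)
    then show ?thesis by (auto simp: PiE_UNIV_domain)
  qed
  let ?tail = "\<lambda>e. closure {ratio d | d. d \<in> D \<and> finer d e}"
  have "?box \<inter> (\<Inter>e\<in>D. ?tail e) \<noteq> {}"
  proof (rule compact_imp_fip_image[OF \<open>compact ?box\<close>])
    fix F assume "finite F" "F \<subseteq> D"
    then have "\<exists>d\<in>D. \<forall>e\<in>F. finer d e" using D_upper[of F] by (simp add: finer_def)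
    then obtain d where d: "d \<in> D" "\<forall>e\<in>F. finer d e" by blast
    then have "ratio d \<in> ?box \<inter> (\<Inter>e\<in>F. ?tail e)"
      using box[OF d(1)] by (intro IntI INT_I subsetD[OF closure_subset]) (use d in auto)
    then show "?box \<inter> (\<Inter>e\<in>F. ?tail e) \<noteq> {}" by blast
  qed auto
  then obtain c where c: "\<And>e. e \<in> D \<Longrightarrow> c \<in> ?tail e" by auto
  show ?thesis
  proof (intro exI allI impI)
    fix S e assume S: "closed S" "e \<in> D" "\<forall>d\<in>D. finer d e \<longrightarrow> ratio d \<in> S"
    then have "?tail e \<subseteq> S" by (intro closure_minimal) auto
    then show "c \<in> S" using c S by auto
  qed
qed

text \<open>
  The second component of the argument may be any set; only its trace on the fibre over the
  first component counts.
\<close>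

definition haar :: "'l \<times> 'k set \<Rightarrow> real" where
  "haar = (SOME c. \<forall>S e. closed S \<longrightarrow> e \<in> D \<longrightarrow> (\<forall>d\<in>D. finer d e \<longrightarrow> ratio d \<in> S) \<longrightarrow> c \<in> S)"

lemma haar_closed:
  "closed S \<Longrightarrow> e \<in> D \<Longrightarrow> (\<And>d. d \<in> D \<Longrightarrow> finer d e \<Longrightarrow> ratio d \<in> S) \<Longrightarrow> haar \<in> S"
  using someI_ex[OF ratio_limit] unfolding haar_def[symmetric] by blast

lemma haar_closed': "closed S \<Longrightarrow> (\<And>d. d \<in> D \<Longrightarrow> ratio d \<in> S) \<Longrightarrow> haar \<in> S"
  using haar_closed D_nonempty by blast

lemma haar_nonneg: "0 \<le> haar i"
proof -
  have "haar \<in> {c. 0 \<le> c i}"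
    by (intro haar_closed' closed_Collect_le continuous_on_product_coordinates continuous_intros)
       (auto simp: ratio_def split: prod.splits)
  then show ?thesis by simp
qed

lemma haar_eqI:
  assumes "\<And>d. d \<in> D \<Longrightarrow> ratio d i = ratio d j"
  shows "haar i = haar j"
proof -
  have "haar \<in> {c. c i = c j}"
    by (intro haar_closed' closed_Collect_eq continuous_on_product_coordinates) (use assms in auto)
  then show ?thesis by simp
qed

lemma haar_restrict: "haar (l, C \<inter> {x. q x = l}) = haar (l, C)"
  by (rule haar_eqI) (simp add: ratio_def Int_assoc)

lemma haar_empty: "haar (l, {}) = 0"
proof -
  have "haar \<in> {c. c (l, {}) = 0}"
    by (intro haar_closed' closed_Collect_eq continuous_on_product_coordinates continuous_intros)
       (auto simp: ratio_def cov_empty)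
  then show ?thesis by simp
qed

lemma haar_total: "haar (l, UNIV) = 1"
proof -
  have "haar \<in> {c. c (l, UNIV) = 1}"
    by (intro haar_closed' closed_Collect_eq continuous_on_product_coordinates continuous_intros)
       (use cov_pos[of _ l] in \<open>force simp: ratio_def\<close>)
  then show ?thesis by simp
qed

lemma haar_mono:
  assumes "A \<subseteq> B"
  shows "haar (l, A) \<le> haar (l, B)"
proof -
  have "haar \<in> {c. c (l, A) \<le> c (l, B)}"
    by (intro haar_closed' closed_Collect_le continuous_on_product_coordinates)
       (use assms in \<open>auto simp: ratio_def intro!: divide_right_mono cov_mono[where l = l]\<close>)
  then show ?thesis by simp
qed

lemma haar_Un: "haar (l, A \<union> B) \<le> haar (l, A) + haar (l, B)"
proof -
  have "haar \<in> {c. c (l, A \<union> B) \<le> c (l, A) + c (l, B)}"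
  proof (intro haar_closed' closed_Collect_le continuous_on_product_coordinates continuous_on_add, safe)
    fix d assume "d \<in> D"
    then show "ratio d (l, A \<union> B) \<le> ratio d (l, A) + ratio d (l, B)"
      using cov_Un[of d "A \<inter> {x. q x = l}" l "B \<inter> {x. q x = l}"]
      by (auto simp: ratio_def Int_Un_distrib2 add_divide_distrib[symmetric] intro!: divide_right_mono)
  qed
  then show ?thesis by simp
qed

lemma haar_Un_disjoint:
  assumes "closed A" "closed B" "A \<inter> B = {}"
  shows "haar (l, A \<union> B) = haar (l, A) + haar (l, B)"
proof -
  obtain e where e: "e \<in> D" "\<forall>x\<in>A. \<forall>y\<in>B. q x = q y \<longrightarrow> 1 \<le> e x y"
    using separate_closed[OF assms] by blast
  have "haar \<in> {c. c (l, A \<union> B) = c (l, A) + c (l, B)}"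
  proof (intro haar_closed[OF _ D_add[OF e(1) e(1)]] closed_Collect_eq
      continuous_on_product_coordinates continuous_on_add CollectI)
    fix d assume d: "d \<in> D" "finer d (\<lambda>x y. e x y + e x y)"
    have "2 \<le> d x y" if "x \<in> A \<inter> {x. q x = l}" "y \<in> B \<inter> {x. q x = l}" for x y
    proof -
      have "q x = q y" "1 \<le> e x y" using e(2) that by auto
      moreover have "e x y + e x y \<le> d x y" using d(2) \<open>q x = q y\<close> by (simp add: finer_def)
      ultimately show ?thesis by linarith
    qed
    then show "ratio d (l, A \<union> B) = ratio d (l, A) + ratio d (l, B)"
      using cov_Un_separated[OF d(1), of "A \<inter> {x. q x = l}" l "B \<inter> {x. q x = l}"]
      by (auto simp: ratio_def Int_Un_distrib2 add_divide_distrib[symmetric])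
  qed
  then show ?thesis by simp
qed

lemma haar_image:
  assumes z: "z \<in> isos l m" and w: "w \<in> isos m l" and A: "A \<subseteq> {x. q x = l}"
  shows "haar (m, z ` A) = haar (l, A)"
proof (rule haar_eqI)
  fix d assume d: "d \<in> D"
  have "z ` A \<inter> {x. q x = m} = z ` A" "A \<inter> {x. q x = l} = A" using isos_fibre[OF z] A by auto
  then show "ratio d (m, z ` A) = ratio d (l, A)"
    using cov_image[OF d z w A] cov_image[OF d z w subset_refl] isos_surj[OF z w]
    by (simp add: ratio_def)
qed

lemma content_haar: "content (\<lambda>C. ennreal (haar (l, C)))"
proof
  show "compact (UNIV :: 'k set)" by (rule compact_K)
qed (auto simp: haar_total closed_compact haar_nonneg simp flip: ennreal_plus
      intro!: ennreal_leI haar_mono haar_Un haar_Un_disjoint compact_imp_closed)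

definition fibre_measure :: "'l \<Rightarrow> 'k measure" where
  "fibre_measure l = content.radon (\<lambda>C. ennreal (haar (l, C)))"

lemma fibre_measure_prob: "fibre_measure l \<in> prob_measures"
  unfolding fibre_measure_def by (rule content.radon_in_prob_measures[OF content_haar])

lemma sets_fibre_measure [simp]: "sets (fibre_measure l) = sets borel"
  using fibre_measure_prob by (simp add: prob_measures_def)

lemma space_fibre_measure [simp]: "space (fibre_measure l) = UNIV"
  using sets_eq_imp_space_eq[OF sets_fibre_measure] by simp

lemma prob_space_fibre_measure: "prob_space (fibre_measure l)"
  using fibre_measure_prob by (simp add: prob_measures_def)

lemma fibre_measure_open:
  "open U \<Longrightarrow> emeasure (fibre_measure l) U = (SUP C \<in> {C. compact C \<and> C \<subseteq> U}. ennreal (haar (l, C)))"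
  unfolding fibre_measure_def
  by (simp add: content.emeasure_radon_open[OF content_haar] content.inner_def[OF content_haar])

lemma fibre_measure_AE: "AE x in fibre_measure l. q x = l"
proof (rule AE_I)
  have "open (- {x. q x = l})" using closed_fibre by auto
  then have "emeasure (fibre_measure l) (- {x. q x = l}) \<le> 0"
    unfolding fibre_measure_open[OF \<open>open (- {x. q x = l})\<close>]
  proof (intro SUP_least)
    fix C assume "C \<in> {C. compact C \<and> C \<subseteq> - {x. q x = l}}"
    then have "C \<inter> {x. q x = l} = {}" by auto
    then show "ennreal (haar (l, C)) \<le> 0" using haar_restrict[of l C] haar_empty by simp
  qed
  then show "emeasure (fibre_measure l) (- {x. q x = l}) = 0" by simp
  show "- {x. q x = l} \<in> sets (fibre_measure l)" using closed_fibre by auto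
qed auto

text \<open>
  Covering numbers are preserved by surjective isometries, hence so are the contents and the
  measures. The map \<open>f\<close> only has to agree with the isometry on the fibre, which carries the
  measure; this covers both the maps \<open>\<phi> g\<close> of an action and truncated isometries.
\<close>

lemma distr_fibre_measure:
  assumes z: "z \<in> isos l m" and w: "w \<in> isos m l"
    and f: "f \<in> borel_measurable borel" "\<And>s. q s = l \<Longrightarrow> f s = z s"
  shows "distr (fibre_measure l) borel f = fibre_measure m"
proof (rule measure_eqI_generator_eq[where E="{U. open U}" and \<Omega>=UNIV and A="\<lambda>_. UNIV"])
  have fm: "f \<in> measurable (fibre_measure l) borel"
    using f(1) by (simp add: measurable_cong_sets[OF sets_fibre_measure HOL.refl])
  fix U :: "'k set" assume "U \<in> {U. open U}"
  then have U: "open U" by simp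
  let ?K = "{x. q x = l}"
  \<comment> \<open>An open set of the whole space whose trace on the fibre is the preimage of \<open>U\<close>.\<close>
  define V where "V = - (?K \<inter> z -` (- U))"
  have "closed (?K \<inter> z -` (- U))"
    by (rule continuous_closed_preimage[OF isos_continuous[OF z] closed_fibre]) (use U in auto)
  then have V: "open V" unfolding V_def by (rule open_Compl)
  have "emeasure (distr (fibre_measure l) borel f) U = emeasure (fibre_measure l) (f -` U)"
    using U by (subst emeasure_distr[OF fm]) auto
  also have "\<dots> = emeasure (fibre_measure l) V"
  proof (rule emeasure_eq_AE)
    show "AE x in fibre_measure l. x \<in> f -` U \<longleftrightarrow> x \<in> V"
      using fibre_measure_AE by eventually_elim (use f(2) in \<open>auto simp: V_def\<close>)
    show "f -` U \<in> sets (fibre_measure l)" using measurable_sets[OF f(1), of U] U by simp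
  qed (use V in auto)
  also have "\<dots> = emeasure (fibre_measure m) U"
    unfolding fibre_measure_open[OF U] fibre_measure_open[OF V]
  proof (rule antisym; rule SUP_least)
    fix C assume C: "C \<in> {C. compact C \<and> C \<subseteq> V}"
    let ?C = "C \<inter> ?K"
    have "compact ?C" using C closed_fibre by (auto intro: compact_Int_closed)
    then have "compact (z ` ?C)"
      by (rule compact_continuous_image[OF continuous_on_subset[OF isos_continuous[OF z]], rotated]) auto
    moreover have "z ` ?C \<subseteq> U" using C by (auto simp: V_def)
    ultimately have "ennreal (haar (m, z ` ?C)) \<le> (SUP C\<in>{C. compact C \<and> C \<subseteq> U}. ennreal (haar (m, C)))"
      by (intro SUP_upper) auto
    then show "ennreal (haar (l, C)) \<le> (SUP C\<in>{C. compact C \<and> C \<subseteq> U}. ennreal (haar (m, C)))"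
      using haar_image[OF z w, of ?C] haar_restrict[of l C] by simp
  next
    fix C assume C: "C \<in> {C. compact C \<and> C \<subseteq> U}"
    let ?C = "?K \<inter> z -` C"
    have "closed ?C"
      by (rule continuous_closed_preimage[OF isos_continuous[OF z] closed_fibre]) (use C compact_imp_closed in auto)
    then have "compact ?C" using closed_compact by simp
    moreover have "?C \<subseteq> V" using C by (auto simp: V_def)
    ultimately have "ennreal (haar (l, ?C)) \<le> (SUP C\<in>{C. compact C \<and> C \<subseteq> V}. ennreal (haar (l, C)))"
      by (intro SUP_upper) auto
    moreover have "z ` ?C = z ` ?K \<inter> C" by auto
    then have "z ` ?C = C \<inter> {x. q x = m}" unfolding isos_surj[OF z w] by auto
    ultimately show "ennreal (haar (m, C)) \<le> (SUP C\<in>{C. compact C \<and> C \<subseteq> V}. ennreal (haar (l, C)))"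
      using haar_image[OF z w, of ?C] haar_restrict[of m C] by simp
  qed
  finally show "emeasure (distr (fibre_measure l) borel f) U = emeasure (fibre_measure m) U" .
next
  have "finite_measure (distr (fibre_measure l) borel f)"
    using f(1) prob_space.prob_space_distr[OF prob_space_fibre_measure[of l], where f = f and M' = borel]
    by (simp add: measurable_cong_sets[OF sets_fibre_measure HOL.refl] prob_space_def)
  then show "emeasure (distr (fibre_measure l) borel f) UNIV \<noteq> \<infinity>"
    using finite_measure.emeasure_finite by auto
qed (auto simp: Int_stable_def borel_def)

end

locale isometric_fibres = fibre_metrics q D
  for q :: "'k::t2_space \<Rightarrow> 'l::t2_space" and D +
  assumes isos_nonempty: "isos l m \<noteq> {}"
begin

text \<open>
  Fix a fibre \<open>?K\<close> and let \<open>Z\<close> be the compact space of all isometries out of it. The target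
  fibre defines a continuous surjection \<open>?Q\<close> of \<open>Z\<close> onto the base, which is a quotient map by
  compactness. So it is enough that the integral is continuous after composition with \<open>?Q\<close>,
  where it becomes an integral of \<open>f \<circ> z\<close> over the fixed fibre. Isometries are equicontinuous,
  so pointwise closeness on a finite net makes these functions uniformly close.
\<close>

lemma continuous_fibre_integral:
  fixes f :: "'k \<Rightarrow> 'b::{banach, second_countable_topology}"
  assumes f: "continuous_on UNIV f"
  shows "continuous_on UNIV (\<lambda>m. \<integral>x. f x \<partial>fibre_measure m)"
proof -
  let ?J = "\<lambda>m. \<integral>x. f x \<partial>fibre_measure m"
  fix l :: 'l
  obtain s0 where s0: "q s0 = l" using fibre_nonempty by blast
  let ?K = "{x. q x = l}"
  let ?Q = "\<lambda>z :: 'k \<Rightarrow> 'k. q (z s0)"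
  define Z where "Z = (\<Union>m. isos l m)"
  \<comment> \<open>Away from the fibre, where \<open>z\<close> is arbitrary, it is replaced by a constant to make it measurable.\<close>
  define trim where "trim z s = (if s \<in> ?K then z s else z s0)" for z :: "'k \<Rightarrow> 'k" and s
  define I where "I z = (\<integral>x. f (trim z x) \<partial>fibre_measure l)" for z
  have Q: "z \<in> isos l (?Q z)" if "z \<in> Z" for z
    using that isos_fibre unfolding Z_def by fastforce
  have "Z = (\<Inter>s. {z. q (z s) = q (z s0)}) \<inter> (\<Inter>d\<in>D. \<Inter>s\<in>?K. \<Inter>t\<in>?K. {z. d (z s) (z t) = d s t})"
    unfolding Z_def isos_def by auto
  then have "closed Z"
    by (simp only:) (intro closed_Int closed_INT ballI closed_Collect_eq continuous_intros coord_continuous)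
  have trim: "trim z \<in> borel_measurable borel" if "z \<in> Z" for z
    unfolding trim_def
    by (rule borel_measurable_continuous_on_if)
       (use closed_fibre isos_continuous[OF Q[OF that]] in auto)
  have fm: "f \<in> borel_measurable borel" by (rule borel_measurable_continuous_onI[OF f])
  have "bounded (range f)" using compact_continuous_image[OF f compact_K] by (rule compact_imp_bounded)
  then obtain B where B: "\<And>x. norm (f x) \<le> B" by (auto simp: bounded_iff)
  interpret prob_space "fibre_measure l" by (rule prob_space_fibre_measure)
  have int: "integrable (fibre_measure l) (\<lambda>x. f (trim z x))" if "z \<in> Z" for z
    by (rule integrable_const_bound[where B=B])
       (use B measurable_compose[OF trim[OF that] fm] in \<open>auto simp: measurable_cong_sets[OF sets_fibre_measure HOL.refl]\<close>)
  have IJ: "I z = ?J (?Q z)" if "z \<in> Z" for z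
  proof -
    obtain w where w: "w \<in> isos (?Q z) l" using isos_nonempty by blast
    have "distr (fibre_measure l) borel (trim z) = fibre_measure (?Q z)"
      by (rule distr_fibre_measure[OF Q[OF that] w trim[OF that]]) (simp add: trim_def)
    then have "?J (?Q z) = (\<integral>x. f x \<partial>distr (fibre_measure l) borel (trim z))" by simp
    also have "\<dots> = I z"
      unfolding I_def
      by (rule integral_distr) (use trim[OF that] fm in \<open>auto simp: measurable_cong_sets[OF sets_fibre_measure HOL.refl]\<close>)
    finally show ?thesis by simp
  qed
  have "continuous_on Z I"
    unfolding continuous_on_def
  proof (intro ballI tendstoI)
    fix z0 and e :: real assume z0: "z0 \<in> Z" and "e > 0"
    have "open {z. dist (f (fst z)) (f (snd z)) < e / 4}"
      by (intro open_Collect_less continuous_intros continuous_on_compose2[OF f]) auto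
    then obtain d where d: "d \<in> D" "\<And>x y. q x = q y \<Longrightarrow> d x y < 1 \<Longrightarrow> dist (f x) (f y) < e / 4"
      using entourage[of "{z. dist (f (fst z)) (f (snd z)) < e / 4}"] \<open>e > 0\<close> by auto
    obtain F where F: "F \<subseteq> ?K" "covers d F ?K" using fibre_totally_bounded[OF d(1)] by blast
    have "\<forall>\<^sub>F z in at z0 within Z. \<forall>s\<in>F. dist (f (z s)) (f (z0 s)) < e / 4"
    proof (intro eventually_ball_finite ballI)
      show "finite F" using F by (simp add: covers_def)
      fix s
      have "continuous_on UNIV (\<lambda>z :: 'k \<Rightarrow> 'k. f (z s))"
        by (rule continuous_on_compose2[OF f coord_continuous]) auto
      then have "((\<lambda>z. f (z s)) \<longlongrightarrow> f (z0 s)) (at z0 within Z)"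
        using continuous_on_subset[of UNIV _ Z] z0 by (auto simp: continuous_on_def)
      then show "\<forall>\<^sub>F z in at z0 within Z. dist (f (z s)) (f (z0 s)) < e / 4"
        using \<open>e > 0\<close> by (intro tendstoD) auto
    qed
    moreover have "\<forall>\<^sub>F z in at z0 within Z. z \<in> Z" by (auto simp: eventually_at_topological)
    ultimately show "\<forall>\<^sub>F z in at z0 within Z. dist (I z) (I z0) < e"
    proof eventually_elim
      case (elim z)
      have near: "dist (f (z y)) (f (z0 y)) \<le> 3 * (e / 4)" if y: "y \<in> ?K" for y
      proof -
        obtain x where x: "x \<in> F" "d x y < 1" using F(2) y unfolding covers_def by blast
        have xK: "q x = l" "q y = l" using F(1) x y by auto
        have "dist (f (z' x)) (f (z' y)) < e / 4" if "z' \<in> Z" for z'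
        proof (rule d(2))
          show "q (z' x) = q (z' y)" using isos_fibre[OF Q[OF that]] by metis
        qed (use isos_dist[OF Q[OF that] d(1) xK] x(2) in simp)
        from this[OF z0] this[OF elim(2)] elim(1) x(1)
        show ?thesis
          using dist_triangle[of "f (z y)" "f (z0 y)" "f (z x)"] dist_triangle[of "f (z x)" "f (z0 y)" "f (z0 x)"]
          by (fastforce simp: dist_commute)
      qed
      have "dist (I z) (I z0) \<le> 3 * (e / 4)"
        unfolding I_def
        by (rule dist_integral_le[OF int[OF elim(2)] int[OF z0]]) (use near s0 in \<open>auto simp: trim_def\<close>)
      then show ?case using \<open>e > 0\<close> by auto
    qed
  qed
  show ?thesis
    unfolding continuous_on_closed_vimage[OF closed_UNIV]
  proof (intro allI impI)
    fix B :: "'b set" assume "closed B"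
    then have "closed (I -` B \<inter> Z)"
      using \<open>continuous_on Z I\<close> continuous_on_closed_vimage[OF \<open>closed Z\<close>] by blast
    then have "compact (I -` B \<inter> Z)"
      using compact_Int_closed[OF compact_UNIV_fun[OF compact_K], of "I -` B \<inter> Z"] by simp
    then have "compact (?Q ` (I -` B \<inter> Z))"
      by (rule compact_continuous_image[rotated]) (intro continuous_intros coord_continuous)
    then have "closed (?Q ` (I -` B \<inter> Z))" by (rule compact_imp_closed)
    moreover have "?Q ` (I -` B \<inter> Z) = ?J -` B \<inter> UNIV"
    proof safe
      fix m assume m: "?J m \<in> B"
      obtain z where z: "z \<in> isos l m" using isos_nonempty by blast
      then have "z \<in> Z" "?Q z = m" using isos_fibre by (auto simp: Z_def)
      then show "m \<in> ?Q ` (I -` B \<inter> Z)" using m IJ[of z] by (intro image_eqI[of _ _ z]) auto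
    qed (use IJ in auto)
    ultimately show "closed (?J -` B \<inter> UNIV)" by simp
  qed
qed

end

section \<open>Supports and the weak* topology\<close>

lemma regular_measure_outer:
  "regular_measure M \<Longrightarrow> A \<in> sets M \<Longrightarrow> emeasure M A = (INF U\<in>{U. open U \<and> A \<subseteq> U}. emeasure M U)"
  unfolding regular_measure_def by blast

lemma regular_measure_inner:
  "regular_measure M \<Longrightarrow> A \<in> sets M \<Longrightarrow> emeasure M A = (SUP C\<in>{C. compact C \<and> C \<subseteq> A}. emeasure M C)"
  unfolding regular_measure_def by blast

text \<open>
  Without a countable base, the complement of the support is a null set only thanks to inner
  regularity: its compact subsets are covered by finitely many open null sets.
\<close>

lemma AE_measure_support:
  fixes M :: "'a::t2_space measure"
  assumes M: "M \<in> prob_measures" and S: "closed S" "measure_support M \<subseteq> S"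
  shows "AE x in M. x \<in> S"
proof (rule AE_I)
  have sets: "sets M = sets borel" and reg: "regular_measure M"
    using M by (auto simp: prob_measures_def)
  show "- S \<in> sets M" using S sets by auto
  then have "emeasure M (- S) = (SUP C\<in>{C. compact C \<and> C \<subseteq> - S}. emeasure M C)"
    by (rule regular_measure_inner[OF reg])
  also have "\<dots> \<le> 0"
  proof (rule SUP_least)
    fix C assume C: "C \<in> {C. compact C \<and> C \<subseteq> - S}"
    have "\<exists>U. open U \<and> x \<in> U \<and> emeasure M U = 0" if "x \<in> C" for x
    proof -
      have "x \<notin> measure_support M" using that C S(2) by blast
      then show ?thesis by (auto simp: measure_support_def)
    qed
    then obtain U where "\<And>x. x \<in> C \<Longrightarrow> open (U x) \<and> x \<in> U x \<and> emeasure M (U x) = 0" by metis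
    then have U: "\<And>x. x \<in> C \<Longrightarrow> open (U x)" "C \<subseteq> (\<Union>x\<in>C. U x)" "\<And>x. x \<in> C \<Longrightarrow> U x \<in> null_sets M"
      using sets by (auto simp: null_sets_def)
    obtain F where F: "F \<subseteq> C" "finite F" "C \<subseteq> (\<Union>x\<in>F. U x)"
      using compactE_image[of C C U] C U(1,2) by auto
    have "(\<Union>x\<in>F. U x) \<in> null_sets M"
      using F U(3) by (intro null_sets_UN' countable_finite) auto
    then have "emeasure M (\<Union>x\<in>F. U x) = 0" "(\<Union>x\<in>F. U x) \<in> sets M" by auto
    then show "emeasure M C \<le> 0" using emeasure_mono[OF F(3), of M] by simp
  qed
  finally show "emeasure M (- S) = 0" by simp
qed auto

lemma measure_support_subset:
  assumes "sets M = sets borel" "closed S" "AE x in M. x \<in> S"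
  shows "measure_support M \<subseteq> S"
proof
  fix x assume x: "x \<in> measure_support M"
  have "emeasure M (- S) = 0"
    using assms emeasure_eq_0_AE[of "\<lambda>x. x \<notin> S" M] sets_eq_imp_space_eq[OF assms(1)]
    by (simp add: Compl_eq)
  then show "x \<in> S" using x assms(2) by (force simp: measure_support_def)
qed

lemma prob_measures_eqI:
  fixes M N :: "'a::t2_space measure"
  assumes cpt: "compact (UNIV :: 'a set)" and M: "M \<in> prob_measures" and N: "N \<in> prob_measures"
    and eq: "\<And>f :: 'a \<Rightarrow> real. continuous_on UNIV f \<Longrightarrow> integral\<^sup>L M f = integral\<^sup>L N f"
  shows "M = N"
proof -
  have le: "emeasure M C \<le> emeasure N C"
    if M: "M \<in> prob_measures" and N: "N \<in> prob_measures" and C: "compact C"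
      and eq: "\<And>f :: 'a \<Rightarrow> real. continuous_on UNIV f \<Longrightarrow> integral\<^sup>L M f = integral\<^sup>L N f"
    for M N :: "'a measure" and C
  proof -
    have [simp]: "sets M = sets borel" "sets N = sets borel" and reg: "regular_measure N"
      using M N by (auto simp: prob_measures_def)
    interpret M: prob_space M using M by (simp add: prob_measures_def)
    interpret N: prob_space N using N by (simp add: prob_measures_def)
    have Cb: "C \<in> sets borel" by (rule borel_closed[OF compact_imp_closed[OF C]])
    have "emeasure M C \<le> emeasure N U" if U: "open U" "C \<subseteq> U" for U
    proof -
      have "closed (- U)" "closed C" "- U \<inter> C = {}" using U C compact_imp_closed by auto
      then obtain f :: "'a \<Rightarrow> real" where f: "continuous_on UNIV f" "\<And>x. f x \<in> {0..1}"
        "\<And>x. x \<in> - U \<Longrightarrow> f x = 0" "\<And>x. x \<in> C \<Longrightarrow> f x = 1"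
        using Urysohn_compact_t2[OF cpt] by metis
      have int: "integrable M f" "integrable N f"
        by (rule continuous_imp_integrable[OF cpt M.finite_measure_axioms _ f(1)], simp)
           (rule continuous_imp_integrable[OF cpt N.finite_measure_axioms _ f(1)], simp)
      have "M.prob C = (\<integral>x. indicator C x \<partial>M)" using Cb by simp
      also have "\<dots> \<le> integral\<^sup>L M f"
        by (rule integral_mono[OF _ int(1)])
           (use f(2,4) Cb in \<open>auto intro!: integrable_real_indicator split: split_indicator simp: less_top[symmetric]\<close>)
      also have "\<dots> = integral\<^sup>L N f" by (rule eq[OF f(1)])
      also have "\<dots> \<le> (\<integral>x. indicator U x \<partial>N)"
        by (rule integral_mono[OF int(2)])
           (use f(2,3) U in \<open>auto intro!: integrable_real_indicator split: split_indicator simp: less_top[symmetric]\<close>)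
      also have "\<dots> = N.prob U" using U by simp
      finally show ?thesis by (simp add: M.emeasure_eq_measure N.emeasure_eq_measure)
    qed
    then have "emeasure M C \<le> (INF U\<in>{U. open U \<and> C \<subseteq> U}. emeasure N U)"
      by (intro INF_greatest) auto
    also have "\<dots> = emeasure N C"
      by (rule regular_measure_outer[OF reg, symmetric]) (simp add: Cb)
    finally show ?thesis .
  qed
  have cc: "emeasure M C = emeasure N C" if "compact C" for C
    using le[OF M N that eq] le[OF N M that eq[symmetric]] by (rule antisym)
  have s: "sets M = sets borel" "sets N = sets borel"
    and r: "regular_measure M" "regular_measure N" using M N by (auto simp: prob_measures_def)
  show ?thesis
  proof (rule measure_eqI)
    fix A assume A: "A \<in> sets M"
    then have "emeasure M A = (SUP C\<in>{C. compact C \<and> C \<subseteq> A}. emeasure M C)"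
      by (rule regular_measure_inner[OF r(1)])
    also have "\<dots> = (SUP C\<in>{C. compact C \<and> C \<subseteq> A}. emeasure N C)" by (rule SUP_cong) (auto intro: cc)
    also have "\<dots> = emeasure N A"
      by (rule regular_measure_inner[OF r(2), symmetric]) (use A s in simp)
    finally show "emeasure M A = emeasure N A" .
  qed (simp add: s)
qed

lemma continuous_map_weak_star_iff:
  fixes \<mu> :: "'l::topological_space \<Rightarrow> 'k::topological_space measure"
  shows "continuous_map euclidean weak_star_topology \<mu> \<longleftrightarrow>
    (\<forall>l. \<mu> l \<in> prob_measures) \<and>
    (\<forall>f :: 'k \<Rightarrow> complex. continuous_on UNIV f \<longrightarrow> continuous_on UNIV (\<lambda>l. integral\<^sup>L (\<mu> l) f))"
    (is "?L \<longleftrightarrow> ?P \<and> ?C")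
proof -
  let ?F = "\<lambda>M. \<lambda>f\<in>cont_funs. integral\<^sup>L M f :: complex"
  have C: "?C \<longleftrightarrow> continuous_map euclidean (product_topology (\<lambda>f. euclidean) cont_funs) (?F \<circ> \<mu>)"
    unfolding continuous_map_componentwise by (auto simp: cont_funs_def o_def)
  show ?thesis
  proof
    assume L: ?L
    have "\<mu> \<in> topspace euclidean \<rightarrow> topspace weak_star_topology" using L by (rule continuous_map_funspace)
    then have ?P by (auto simp: topspace_weak_star_topology)
    moreover have "continuous_map weak_star_topology (product_topology (\<lambda>f. euclidean) cont_funs) (id \<circ> ?F)"
      unfolding weak_star_topology_def by (rule continuous_map_pullback) (simp add: id_def)
    then have ?C unfolding C using continuous_map_compose[OF L] by simp
    ultimately show "?P \<and> ?C" ..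
  next
    assume "?P \<and> ?C"
    then show ?L unfolding weak_star_topology_def C
      by (intro continuous_map_pullback') auto
  qed
qed


section \<open>Uniqueness and full support\<close>

sublocale isometric_action \<subseteq> isometric_fibres
  by unfold_locales (rule isos_nonempty)

context isometric_action
begin

text \<open>
  The properties of relatively invariant measures that the arguments below use, with real test
  functions and with supports replaced by null sets.
\<close>

definition invariant_family :: "('l \<Rightarrow> 'k measure) \<Rightarrow> bool" where
  "invariant_family \<nu> \<longleftrightarrow>
     (\<forall>l. \<nu> l \<in> prob_measures) \<and>
     (\<forall>l. AE x in \<nu> l. q x = l) \<and>
     (\<forall>f :: 'k \<Rightarrow> real. continuous_on UNIV f \<longrightarrow> continuous_on UNIV (\<lambda>l. integral\<^sup>L (\<nu> l) f)) \<and>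
     (\<forall>g l. distr (\<nu> l) borel (\<phi> g) = \<nu> (\<psi> g l))"

lemma invariant_familyD:
  assumes "invariant_family \<nu>"
  shows "\<nu> l \<in> prob_measures" "sets (\<nu> l) = sets borel" "space (\<nu> l) = UNIV" "prob_space (\<nu> l)"
    "AE x in \<nu> l. q x = l" "continuous_on UNIV f \<Longrightarrow> continuous_on UNIV (\<lambda>l. integral\<^sup>L (\<nu> l) (f :: 'k \<Rightarrow> real))"
    "distr (\<nu> l) borel (\<phi> g) = \<nu> (\<psi> g l)"
    and "continuous_on UNIV f \<Longrightarrow> integrable (\<nu> l) (f :: 'k \<Rightarrow> real)"
proof -
  show 1: "\<nu> l \<in> prob_measures" using assms by (simp add: invariant_family_def)
  then show 2: "sets (\<nu> l) = sets borel" and 3: "prob_space (\<nu> l)" by (auto simp: prob_measures_def)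
  from sets_eq_imp_space_eq[OF 2] show "space (\<nu> l) = UNIV" by simp
  show "continuous_on UNIV f \<Longrightarrow> integrable (\<nu> l) f"
    using continuous_imp_integrable[OF compact_K _ 2] 3 by (simp add: prob_space_def)
qed (use assms in \<open>auto simp: invariant_family_def\<close>)

text \<open>
  A continuous kernel that is positive precisely on the pairs with \<open>d x y < 1\<close>. On pairs in a
  common fibre it is invariant under the action.
\<close>

definition bump :: "('k \<Rightarrow> 'k \<Rightarrow> real) \<Rightarrow> 'k \<Rightarrow> 'k \<Rightarrow> real" where
  "bump d x y = max 0 (1 - d x y)"

lemma bump_nonneg: "0 \<le> bump d x y"
  by (simp add: bump_def)

lemma bump_continuous: "d \<in> D \<Longrightarrow> continuous_on UNIV (\<lambda>(x, y). bump d x y)"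
  unfolding bump_def split_beta by (intro continuous_intros)

lemma bump_continuous_right: "d \<in> D \<Longrightarrow> continuous_on UNIV (bump d x)"
  unfolding bump_def by (intro continuous_intros)

lemma bump_continuous_left: "d \<in> D \<Longrightarrow> continuous_on UNIV (\<lambda>x. bump d x y)"
  unfolding bump_def by (intro continuous_intros)

text \<open>
  The second use of ergodicity: the mean of the kernel with respect to the measure on the fibre
  of \<open>x\<close> is a continuous invariant function of \<open>x\<close>. It plays the role of the translation-invariant
  volume of a ball.
\<close>

lemma mean_constant:
  assumes \<nu>: "invariant_family \<nu>" and d: "d \<in> D"
  shows "(\<integral>y. bump d x y \<partial>\<nu> (q x)) = (\<integral>y. bump d x' y \<partial>\<nu> (q x'))"
proof (rule \<phi>_ergodic[where f="\<lambda>x. \<integral>y. bump d x y \<partial>\<nu> (q x)"])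
  note N = invariant_familyD[OF \<nu>]
  show "continuous_on UNIV (\<lambda>x. \<integral>y. bump d x y \<partial>\<nu> (q x))"
    unfolding continuous_on_def
  proof (intro ballI tendstoI)
    fix x0 and e :: real assume "e > 0"
    have "continuous_on (UNIV \<times> UNIV) (\<lambda>(x, y). bump d x y)" using bump_continuous[OF d] by simp
    moreover have "e / 2 > 0" using \<open>e > 0\<close> by simp
    ultimately obtain X where X: "x0 \<in> X" "open X"
      "\<forall>x\<in>X \<inter> UNIV. \<forall>y\<in>UNIV. dist (case (x, y) of (x, y) \<Rightarrow> bump d x y) (case (x0, y) of (x, y) \<Rightarrow> bump d x y) \<le> e / 2"
      by (rule continuous_on_prod_compactE[OF _ compact_K UNIV_I])
    have "continuous_on UNIV (\<lambda>x. \<integral>y. bump d x0 y \<partial>\<nu> (q x))"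
      by (rule continuous_on_compose2[OF N(6)[OF bump_continuous_right[OF d]] q_continuous]) simp
    then have "((\<lambda>x. \<integral>y. bump d x0 y \<partial>\<nu> (q x)) \<longlongrightarrow> (\<integral>y. bump d x0 y \<partial>\<nu> (q x0))) (at x0 within UNIV)"
      by (simp add: continuous_on_def)
    then have "\<forall>\<^sub>F x in at x0 within UNIV. dist (\<integral>y. bump d x0 y \<partial>\<nu> (q x)) (\<integral>y. bump d x0 y \<partial>\<nu> (q x0)) < e / 2"
      using \<open>e > 0\<close> by (intro tendstoD) auto
    moreover have "\<forall>\<^sub>F x in at x0 within UNIV. x \<in> X" using X by (auto simp: eventually_at_topological)
    ultimately show "\<forall>\<^sub>F x in at x0 within UNIV.
      dist (\<integral>y. bump d x y \<partial>\<nu> (q x)) (\<integral>y. bump d x0 y \<partial>\<nu> (q x0)) < e"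
    proof eventually_elim
      case (elim x)
      have "dist (\<integral>y. bump d x y \<partial>\<nu> (q x)) (\<integral>y. bump d x0 y \<partial>\<nu> (q x)) \<le> e / 2"
        using X(3) elim(2)
        by (intro prob_space.dist_integral_le[OF N(4)] N(8) bump_continuous_right d) auto
      then show ?case
        using elim(1) dist_triangle[of "\<integral>y. bump d x y \<partial>\<nu> (q x)" "\<integral>y. bump d x0 y \<partial>\<nu> (q x0)" "\<integral>y. bump d x0 y \<partial>\<nu> (q x)"]
        by linarith
    qed
  qed
  fix g x
  have meas: "\<phi> g \<in> measurable (\<nu> (q x)) borel"
    using borel_measurable_continuous_onI[OF \<phi>_continuous] by (simp add: measurable_cong_sets[OF N(2) HOL.refl])
  have "(\<integral>y. bump d (\<phi> g x) y \<partial>\<nu> (q (\<phi> g x))) = (\<integral>y. bump d (\<phi> g x) y \<partial>distr (\<nu> (q x)) borel (\<phi> g))"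
    by (simp add: equivariant N(7))
  also have "\<dots> = (\<integral>y. bump d (\<phi> g x) (\<phi> g y) \<partial>\<nu> (q x))"
    by (rule integral_distr[OF meas]) (intro borel_measurable_continuous_onI bump_continuous_right d)
  also have "\<dots> = (\<integral>y. bump d x y \<partial>\<nu> (q x))"
  proof (rule integral_cong_AE)
    show "AE y in \<nu> (q x). bump d (\<phi> g x) (\<phi> g y) = bump d x y"
      using N(5)[of "q x"] by eventually_elim (simp add: bump_def isometric[OF d])
    have b: "bump d z \<in> borel_measurable borel" for z
      by (intro borel_measurable_continuous_onI bump_continuous_right d)
    show "(\<lambda>y. bump d (\<phi> g x) (\<phi> g y)) \<in> borel_measurable (\<nu> (q x))"
      by (rule measurable_compose[OF meas b])
    show "bump d x \<in> borel_measurable (\<nu> (q x))"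
      using b by (simp add: measurable_cong_sets[OF N(2) HOL.refl])
  qed
  finally show "(\<integral>y. bump d (\<phi> g x) y \<partial>\<nu> (q (\<phi> g x))) = (\<integral>y. bump d x y \<partial>\<nu> (q x))" .
qed

lemma mean_zero_iff:
  assumes \<nu>: "invariant_family \<nu>" and d: "d \<in> D"
  shows "(\<integral>y. bump d x y \<partial>\<nu> l) = 0 \<longleftrightarrow> (AE y in \<nu> l. 1 \<le> d x y)"
proof -
  have "(\<integral>y. bump d x y \<partial>\<nu> l) = 0 \<longleftrightarrow> (AE y in \<nu> l. bump d x y = 0)"
    by (rule integral_nonneg_eq_0_iff_AE)
       (auto intro: invariant_familyD(8)[OF \<nu>] bump_continuous_right d bump_nonneg)
  also have "(\<lambda>y. bump d x y = 0) = (\<lambda>y. 1 \<le> d x y)" by (auto simp: bump_def)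
  finally show ?thesis .
qed

text \<open>
  If the constant mean were zero, every ball of radius 1 would be a null set, and finitely many
  of them cover the fibre.
\<close>

lemma mean_pos:
  assumes \<nu>: "invariant_family \<nu>" and d: "d \<in> D"
  shows "0 < (\<integral>y. bump d x y \<partial>\<nu> (q x))"
proof (rule ccontr)
  assume "\<not> 0 < (\<integral>y. bump d x y \<partial>\<nu> (q x))"
  moreover have "0 \<le> (\<integral>y. bump d x y \<partial>\<nu> (q x))" by (simp add: bump_nonneg)
  ultimately have "(\<integral>y. bump d x y \<partial>\<nu> (q x)) = 0" by simp
  then have zero: "(\<integral>y. bump d x' y \<partial>\<nu> (q x')) = 0" for x'
    using mean_constant[OF \<nu> d, of x x'] by simp
  obtain F where F: "F \<subseteq> {x'. q x' = q x}" "covers d F {x'. q x' = q x}"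
    using fibre_totally_bounded[OF d] by blast
  have "AE y in \<nu> (q x). \<forall>x'\<in>F. 1 \<le> d x' y"
  proof (rule AE_finite_allI)
    show "finite F" using F by (simp add: covers_def)
    fix x' assume "x' \<in> F"
    then show "AE y in \<nu> (q x). 1 \<le> d x' y"
      using zero[of x'] mean_zero_iff[OF \<nu> d, where x = x' and l = "q x"] F(1) by auto
  qed
  with invariant_familyD(5)[OF \<nu>, of "q x"] have "AE y in \<nu> (q x). False"
    by eventually_elim (use F(2) in \<open>force simp: covers_def\<close>)
  then show False using prob_space.AE_False[OF invariant_familyD(4)[OF \<nu>]] by blast
qed

text \<open>
  Some ball around \<open>x\<close> lies in \<open>U\<close>, and no ball is a null set because the means are positive.
\<close>

lemma invariant_family_positive:
  assumes \<nu>: "invariant_family \<nu>" and U: "open U" "x \<in> U"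
  shows "0 < emeasure (\<nu> (q x)) U"
proof (rule ccontr)
  assume "\<not> 0 < emeasure (\<nu> (q x)) U"
  then have "U \<in> null_sets (\<nu> (q x))"
    using U by (simp add: null_sets_def invariant_familyD(2)[OF \<nu>])
  then have "AE y in \<nu> (q x). y \<notin> U" by (rule AE_not_in)
  obtain d where d: "d \<in> D" "\<forall>y. q y = q x \<longrightarrow> d x y < 1 \<longrightarrow> y \<in> U"
    using fibre_nhd[OF U] by blast
  from \<open>AE y in \<nu> (q x). y \<notin> U\<close> invariant_familyD(5)[OF \<nu>, of "q x"]
  have "AE y in \<nu> (q x). 1 \<le> d x y" by eventually_elim (use d(2) in force)
  then have "(\<integral>y. bump d x y \<partial>\<nu> (q x)) = 0" using mean_zero_iff[OF \<nu> d(1)] by simp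
  then show False using mean_pos[OF \<nu> d(1), of x] by simp
qed

text \<open>
  The uniqueness proof for Haar measure. Integrate \<open>f x * bump d x y\<close> over \<open>x\<close> and \<open>y\<close>: integration
  over \<open>y\<close> first gives \<open>b\<close> times the integral of \<open>f\<close>; integration over \<open>x\<close> first gives about
  \<open>a * f y\<close>, because on the fibre the kernel vanishes unless \<open>f x\<close> is within \<open>e\<close> of \<open>f y\<close>.
\<close>

lemma mean_swap:
  fixes f :: "'k \<Rightarrow> real"
  assumes \<mu>: "invariant_family \<mu>" and \<nu>: "invariant_family \<nu>" and d: "d \<in> D"
    and f: "continuous_on UNIV f" and close: "\<And>x y. q x = q y \<Longrightarrow> d x y < 1 \<Longrightarrow> \<bar>f x - f y\<bar> \<le> e"
    and a: "\<And>x. (\<integral>y. bump d x y \<partial>\<mu> (q x)) = a" and b: "\<And>x. (\<integral>y. bump d x y \<partial>\<nu> (q x)) = b"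
  shows "\<bar>b * (\<integral>x. f x \<partial>\<mu> l) - a * (\<integral>x. f x \<partial>\<nu> l)\<bar> \<le> e * a"
proof -
  note M = invariant_familyD[OF \<mu>] and N = invariant_familyD[OF \<nu>]
  interpret M: prob_space "\<mu> l" by (rule M(4))
  interpret N: prob_space "\<nu> l" by (rule N(4))
  interpret P: pair_prob_space "\<mu> l" "\<nu> l" ..
  let ?h = "\<lambda>x y. f x * bump d x y"
  have h: "continuous_on UNIV (\<lambda>(x, y). ?h x y)"
    using bump_continuous[OF d] unfolding split_beta
    by (intro continuous_on_mult continuous_on_compose2[OF f continuous_on_fst[OF continuous_on_id]]) auto
  have hl: "continuous_on UNIV (\<lambda>x. ?h x y)" for y
    by (intro continuous_intros f bump_continuous_left d)
  have "bounded (range (\<lambda>(x, y). ?h x y))"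
    by (intro compact_imp_bounded compact_continuous_image[OF h] compact_UNIV_Times compact_K)
  then obtain B where B: "\<And>z. norm (case z of (x, y) \<Rightarrow> ?h x y) \<le> B" by (auto simp: bounded_iff)
  have hm: "(\<lambda>(x, y). ?h x y) \<in> borel_measurable (\<mu> l \<Otimes>\<^sub>M \<nu> l)"
    using borel_measurable_kernel[OF compact_K compact_K h]
    by (simp add: measurable_cong_sets[OF sets_pair_measure_cong[OF M(2) N(2)] HOL.refl])
  have hi: "integrable (\<mu> l \<Otimes>\<^sub>M \<nu> l) (\<lambda>(x, y). ?h x y)"
    by (rule P.integrable_const_bound[OF AE_I2[OF B] hm])
  have "b * (\<integral>x. f x \<partial>\<mu> l) = (\<integral>x. b * f x \<partial>\<mu> l)" by simp
  also have "\<dots> = (\<integral>x. (\<integral>y. ?h x y \<partial>\<nu> l) \<partial>\<mu> l)"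
  proof (rule integral_cong_AE)
    show "AE x in \<mu> l. b * f x = (\<integral>y. ?h x y \<partial>\<nu> l)"
      using M(5)[of l] by eventually_elim (use b in auto)
    show "(\<lambda>x. b * f x) \<in> borel_measurable (\<mu> l)"
      using M(8)[OF f, of l] by (auto intro: borel_measurable_integrable)
    show "(\<lambda>x. \<integral>y. ?h x y \<partial>\<nu> l) \<in> borel_measurable (\<mu> l)"
      by (rule N.borel_measurable_lebesgue_integral[OF hm])
  qed
  also have "\<dots> = (\<integral>y. (\<integral>x. ?h x y \<partial>\<mu> l) \<partial>\<nu> l)" by (rule P.Fubini_integral[OF hi, symmetric])
  finally have eq: "b * (\<integral>x. f x \<partial>\<mu> l) = (\<integral>y. (\<integral>x. ?h x y \<partial>\<mu> l) \<partial>\<nu> l)" .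
  have "dist (\<integral>y. (\<integral>x. ?h x y \<partial>\<mu> l) \<partial>\<nu> l) (\<integral>y. a * f y \<partial>\<nu> l) \<le> e * a"
  proof (rule N.dist_integral_le)
    show "integrable (\<nu> l) (\<lambda>y. \<integral>x. ?h x y \<partial>\<mu> l)" by (rule P.integrable_snd[OF hi])
    show "integrable (\<nu> l) (\<lambda>y. a * f y)" using N(8)[OF f, of l] by simp
    show "AE y in \<nu> l. dist (\<integral>x. ?h x y \<partial>\<mu> l) (a * f y) \<le> e * a"
      using N(5)[of l]
    proof eventually_elim
      case (elim y)
      have ay: "(\<integral>x. bump d x y \<partial>\<mu> l) = a"
      proof -
        have "(\<integral>x. bump d x y \<partial>\<mu> l) = (\<integral>x. bump d y x \<partial>\<mu> l)"
        proof (rule integral_cong_AE)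
          show "AE x in \<mu> l. bump d x y = bump d y x"
            using M(5)[of l] by eventually_elim (use elim sym[OF d] in \<open>auto simp: bump_def\<close>)
        qed (auto intro!: borel_measurable_integrable M(8) bump_continuous_left bump_continuous_right d)
        then show ?thesis using a[of y] elim by simp
      qed
      have i1: "integrable (\<mu> l) (\<lambda>x. ?h x y)" by (rule M(8)[OF hl])
      have i2: "integrable (\<mu> l) (\<lambda>x. bump d x y)" by (rule M(8)[OF bump_continuous_left[OF d]])
      have "dist (\<integral>x. ?h x y \<partial>\<mu> l) (a * f y) = \<bar>\<integral>x. ?h x y - f y * bump d x y \<partial>\<mu> l\<bar>"
        using i1 i2 by (simp add: dist_real_def ay mult.commute)
      also have "\<dots> \<le> (\<integral>x. \<bar>?h x y - f y * bump d x y\<bar> \<partial>\<mu> l)" by (rule integral_abs_bound)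
      also have "\<dots> \<le> (\<integral>x. e * bump d x y \<partial>\<mu> l)"
      proof (rule integral_mono_AE)
        show "AE x in \<mu> l. \<bar>?h x y - f y * bump d x y\<bar> \<le> e * bump d x y"
          using M(5)[of l]
        proof eventually_elim
          case x: (elim x)
          show ?case
          proof (cases "d x y < 1")
            case True
            then have "\<bar>f x - f y\<bar> \<le> e" using close x elim by simp
            then have "\<bar>f x - f y\<bar> * bump d x y \<le> e * bump d x y"
              by (rule mult_right_mono) (rule bump_nonneg)
            then show ?thesis
              by (simp add: left_diff_distrib[symmetric] abs_mult bump_nonneg)
          qed (simp add: bump_def)
        qed
      qed (use i1 i2 in auto)
      also have "\<dots> = e * a" by (simp add: ay)
      finally show ?case .
    qed
  qed
  then show ?thesis unfolding eq[symmetric] by (simp add: dist_real_def)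
qed

lemma invariant_family_unique:
  assumes \<mu>: "invariant_family \<mu>" and \<nu>: "invariant_family \<nu>"
  shows "\<mu> = \<nu>"
proof
  fix l
  show "\<mu> l = \<nu> l"
  proof (rule prob_measures_eqI[OF compact_K])
    show "\<mu> l \<in> prob_measures" "\<nu> l \<in> prob_measures" by (simp_all add: invariant_familyD(1) \<mu> \<nu>)
    fix f :: "'k \<Rightarrow> real" assume f: "continuous_on UNIV f"
    have "\<bar>integral\<^sup>L (\<mu> l) f - integral\<^sup>L (\<nu> l) f\<bar> \<le> e" if "e > 0" for e
    proof -
      have "open {z. \<bar>f (fst z) - f (snd z)\<bar> < e}"
        by (intro open_Collect_less continuous_intros continuous_on_compose2[OF f]) auto
      then have "\<exists>d\<in>D. \<forall>x y. q x = q y \<longrightarrow> d x y < 1 \<longrightarrow> (x, y) \<in> {z. \<bar>f (fst z) - f (snd z)\<bar> < e}"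
        by (rule entourage) (use \<open>e > 0\<close> in auto)
      then obtain d where d: "d \<in> D" "\<And>x y. q x = q y \<Longrightarrow> d x y < 1 \<Longrightarrow> \<bar>f x - f y\<bar> \<le> e"
        by (auto intro: less_imp_le)
      define a where "a = (\<integral>y. bump d undefined y \<partial>\<mu> (q undefined))"
      define b where "b = (\<integral>y. bump d undefined y \<partial>\<nu> (q undefined))"
      have ab: "(\<integral>y. bump d x y \<partial>\<mu> (q x)) = a" "(\<integral>y. bump d x y \<partial>\<nu> (q x)) = b" for x
        unfolding a_def b_def using mean_constant[OF _ d(1)] \<mu> \<nu> by blast+
      have "a > 0" unfolding a_def by (rule mean_pos[OF \<mu> d(1)])
      interpret M: prob_space "\<mu> l" by (rule invariant_familyD(4)[OF \<mu>])
      interpret N: prob_space "\<nu> l" by (rule invariant_familyD(4)[OF \<nu>])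
      \<comment> \<open>The function 1 does not vary at all; comparing its integrals shows that both means agree.\<close>
      have "\<bar>b * (\<integral>x. 1 \<partial>\<mu> l) - a * (\<integral>x. 1 \<partial>\<nu> l)\<bar> \<le> 0 * a"
        by (rule mean_swap[OF \<mu> \<nu> d(1) _ _ ab]) auto
      then have "b = a" by (simp add: M.prob_space N.prob_space)
      moreover have "\<bar>b * (\<integral>x. f x \<partial>\<mu> l) - a * (\<integral>x. f x \<partial>\<nu> l)\<bar> \<le> e * a"
        by (rule mean_swap[OF \<mu> \<nu> d(1) f d(2) ab])
      ultimately have "a * \<bar>(\<integral>x. f x \<partial>\<mu> l) - (\<integral>x. f x \<partial>\<nu> l)\<bar> \<le> a * e"
        using \<open>a > 0\<close> by (simp add: right_diff_distrib[symmetric] abs_mult mult.commute)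
      then show ?thesis using \<open>a > 0\<close> by simp
    qed
    then show "integral\<^sup>L (\<mu> l) f = integral\<^sup>L (\<nu> l) f"
      by (metis abs_le_zero_iff eq_iff_diff_eq_0 field_le_epsilon add_0)
  qed
qed

lemma relatively_invariant_imp_invariant_family:
  assumes \<nu>: "relatively_invariant_measure \<phi> \<psi> q \<nu>"
  shows "invariant_family \<nu>"
proof -
  have P: "\<And>l. \<nu> l \<in> prob_measures"
    and C: "\<And>f :: 'k \<Rightarrow> complex. continuous_on UNIV f \<Longrightarrow> continuous_on UNIV (\<lambda>l. integral\<^sup>L (\<nu> l) f)"
    and S: "\<And>l. measure_support (\<nu> l) \<subseteq> {x. q x = l}"
    and G: "\<And>g l. distr (\<nu> l) borel (\<phi> g) = \<nu> (\<psi> g l)"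
    using \<nu> by (auto simp: relatively_invariant_measure_def continuous_map_weak_star_iff fiber_def vimage_def)
  show ?thesis
    unfolding invariant_family_def
  proof (intro conjI allI impI P G)
    fix l show "AE x in \<nu> l. q x = l"
      using AE_measure_support[OF P closed_fibre S] by simp
  next
    fix f :: "'k \<Rightarrow> real" assume f: "continuous_on UNIV f"
    have "continuous_on UNIV (\<lambda>l. Re (\<integral>x. complex_of_real (f x) \<partial>\<nu> l))"
      by (intro continuous_intros C f)
    then show "continuous_on UNIV (\<lambda>l. integral\<^sup>L (\<nu> l) f)" by simp
  qed
qed

lemma relatively_invariant_fibre_measure: "relatively_invariant_measure \<phi> \<psi> q fibre_measure"
  unfolding relatively_invariant_measure_def continuous_map_weak_star_iff
proof (intro conjI allI impI fibre_measure_prob continuous_fibre_integral)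
  fix l show "measure_support (fibre_measure l) \<subseteq> fiber q l"
    unfolding fiber_def vimage_def
    by (rule measure_support_subset) (use closed_fibre fibre_measure_AE in auto)
next
  fix g l
  obtain s0 where s0: "q s0 = l" using fibre_nonempty by blast
  let ?z = "\<lambda>s. if q s = l then \<phi> g s else \<phi> g s0"
  have z: "?z \<in> isos l (\<psi> g l)"
    using s0 by (auto simp: isos_def equivariant isometric)
  obtain w where w: "w \<in> isos (\<psi> g l) l" using isos_nonempty by blast
  show "distr (fibre_measure l) borel (\<phi> g) = fibre_measure (\<psi> g l)"
    by (rule distr_fibre_measure[OF z w borel_measurable_continuous_onI[OF \<phi>_continuous]]) simp
qed

lemma relatively_invariant_unique:
  "relatively_invariant_measure \<phi> \<psi> q \<nu> \<Longrightarrow> \<nu> = fibre_measure"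
  using invariant_family_unique relatively_invariant_imp_invariant_family relatively_invariant_fibre_measure
  by blast

lemma relatively_invariant_fully_supported:
  assumes "relatively_invariant_measure \<phi> \<psi> q \<nu>"
  shows "fully_supported q \<nu>"
  unfolding fully_supported_def
proof (intro allI antisym)
  fix l
  show "measure_support (\<nu> l) \<subseteq> fiber q l" using assms by (simp add: relatively_invariant_measure_def)
  show "fiber q l \<subseteq> measure_support (\<nu> l)"
    using invariant_family_positive[OF relatively_invariant_imp_invariant_family[OF assms]]
    by (auto simp: fiber_def measure_support_def)
qed

end

section \<open>Pseudoisometric extensions\<close>

text \<open>
  Points that no pseudometric separates have the same generated neighbourhoods.
\<close>

lemma pseudometrics_topology_separates:
  assumes P: "\<And>p. p \<in> P \<Longrightarrow> pseudometric_on S p"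
    and top: "pseudometrics_topology S P = top_of_set S"
    and x: "x \<in> S" and y: "y \<in> (S :: 'k::t1_space set)" and "x \<noteq> y"
  shows "\<exists>p\<in>P. 0 < p (x, y)"
proof (rule ccontr)
  assume none: "\<not> (\<exists>p\<in>P. 0 < p (x, y))"
  have eq: "p (c, x) = p (c, y)" if p: "p \<in> P" and c: "c \<in> S" for p c
  proof -
    have pm: "\<And>u v. u \<in> S \<Longrightarrow> v \<in> S \<Longrightarrow> 0 \<le> p (u, v)"
      "\<And>u v. u \<in> S \<Longrightarrow> v \<in> S \<Longrightarrow> p (u, v) = p (v, u)"
      "\<And>u v w. u \<in> S \<Longrightarrow> v \<in> S \<Longrightarrow> w \<in> S \<Longrightarrow> p (u, w) \<le> p (u, v) + p (v, w)"
      using P[OF p] by (simp_all add: pseudometric_on_def)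
    have "p (x, y) = 0" using none p pm(1)[OF x y] by force
    then show ?thesis using pm(2)[OF x y] pm(3)[OF c x y] pm(3)[OF c y x] by simp
  qed
  have "x \<in> U \<longleftrightarrow> y \<in> U"
    if "generate_topology_on (insert S {{y \<in> S. p (x, y) < r} | p x r. p \<in> P \<and> x \<in> S \<and> 0 < r}) U" for U
    using that
  proof induction
    case (Basis U)
    show ?case
    proof (cases "U = S")
      case False
      then obtain p c r where "p \<in> P" "c \<in> S" "U = {y \<in> S. p (c, y) < r}" using Basis by blast
      then show ?thesis using eq[of p c] x y by simp
    qed (use x y in simp)
  qed auto
  then have same: "x \<in> U \<longleftrightarrow> y \<in> U" if "openin (top_of_set S) U" for U
    using that unfolding top[symmetric] pseudometrics_topology_def openin_topology_generated_by_iff by blast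
  obtain U where "open U" "x \<in> U" "y \<notin> U" using t1_space[OF \<open>x \<noteq> y\<close>] by blast
  then have "x \<in> S \<inter> U" "y \<notin> S \<inter> U" "openin (top_of_set S) (S \<inter> U)" using x by auto
  then show False using same by blast
qed

text \<open>
  The pseudometrics as functions on the whole square. That they generate the topology of the
  fibres is weakened to separation of points; compactness gives it back.
\<close>

definition separating_kernels ::
  "('g \<Rightarrow> 'k::topological_space \<Rightarrow> 'k) \<Rightarrow> ('k \<Rightarrow> 'l) \<Rightarrow> ('k \<times> 'k \<Rightarrow> real) set \<Rightarrow> bool" where
  "separating_kernels \<phi> q E \<longleftrightarrow>
    (\<forall>p\<in>E. continuous_on UNIV p \<and> (\<forall>l. pseudometric_on {x. q x = l} p) \<and>
       (\<forall>x y g. q x = q y \<longrightarrow> p (\<phi> g x, \<phi> g y) = p (x, y))) \<and>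
    (\<forall>x y. q x = q y \<longrightarrow> x \<noteq> y \<longrightarrow> (\<exists>p\<in>E. 0 < p (x, y)))"

text \<open>
  The fibre product is closed, so Tietze's theorem extends the given pseudometrics.
\<close>

lemma pseudoisometric_kernels:
  fixes \<phi> :: "'g \<Rightarrow> 'k::t2_space \<Rightarrow> 'k" and q :: "'k \<Rightarrow> 'l::t2_space"
  assumes cpt: "compact (UNIV :: 'k set)" and qc: "continuous_on UNIV q"
    and iso: "pseudoisometric \<phi> q" and \<phi>: "\<And>g x y. q x = q y \<Longrightarrow> q (\<phi> g x) = q (\<phi> g y)"
  shows "\<exists>E. separating_kernels \<phi> q E"
proof -
  obtain P where P: "\<And>p. p \<in> P \<Longrightarrow> continuous_on (fiber_prod q) p"
    "\<And>l p. p \<in> P \<Longrightarrow> pseudometric_on (fiber q l) p"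
    "\<And>l. pseudometrics_topology (fiber q l) P = top_of_set (fiber q l)"
    "\<And>p x y g. p \<in> P \<Longrightarrow> (x, y) \<in> fiber_prod q \<Longrightarrow> p (\<phi> g x, \<phi> g y) = p (x, y)"
    using iso unfolding pseudoisometric_def by fast
  have F: "fiber q l = {x. q x = l}" for l by (auto simp: fiber_def)
  have "fiber_prod q = {z. q (fst z) = q (snd z)}" by (auto simp: fiber_prod_def)
  then have "closed (fiber_prod q)"
    by (simp only:) (intro closed_Collect_eq continuous_on_compose2[OF qc] continuous_intros; simp)
  then have "\<exists>g. continuous_on UNIV g \<and> (\<forall>z\<in>fiber_prod q. g z = p z)" if "p \<in> P" for p
    using Tietze_compact_t2[OF compact_UNIV_Times[OF cpt cpt] _ P(1)[OF that]] by simp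
  then obtain ext where ext: "\<And>p. p \<in> P \<Longrightarrow> continuous_on UNIV (ext p)"
    "\<And>p z. p \<in> P \<Longrightarrow> z \<in> fiber_prod q \<Longrightarrow> ext p z = p z" by metis
  have e: "ext p (x, y) = p (x, y)" if "p \<in> P" "q x = q y" for p x y
    using ext(2)[OF that(1)] that(2) by (simp add: fiber_prod_def)
  show ?thesis
    unfolding separating_kernels_def
  proof (intro exI[of _ "ext ` P"] conjI ballI allI impI)
    fix p l assume "p \<in> ext ` P"
    then obtain p' where p': "p' \<in> P" "p = ext p'" by auto
    show "continuous_on UNIV p" using ext(1) p' by simp
    show "pseudometric_on {x. q x = l} p"
      using P(2)[OF p'(1), of l] unfolding F pseudometric_on_def p'(2) by (simp add: e[OF p'(1)])
    show "p (\<phi> g x, \<phi> g y) = p (x, y)" if "q x = q y" for x y g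
      using P(4)[OF p'(1), of x y g] that \<phi>[OF that] by (simp add: p'(2) e[OF p'(1)] fiber_prod_def)
  next
    fix x y assume "q x = q y" "x \<noteq> y"
    then have "\<exists>p\<in>P. 0 < p (x, y)"
      using pseudometrics_topology_separates[OF P(2) P(3)[of "q x"], of x y] by (simp add: F)
    then show "\<exists>p\<in>ext ` P. 0 < p (x, y)" using e \<open>q x = q y\<close> by auto
  qed
qed

theorem theorem7p3:
  fixes \<phi> :: "'g::{topological_group_add, t2_space} \<Rightarrow> 'k::t2_space \<Rightarrow> 'k"
    and \<psi> :: "'g \<Rightarrow> 'l::t2_space \<Rightarrow> 'l"
    and q :: "'k \<Rightarrow> 'l"
  assumes "open_extension \<phi> \<psi> q"
    and "pseudoisometric \<phi> q"
    and "top_ergodic \<phi>"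
    and "top_ergodic \<psi>"
  shows "(\<exists>!\<mu>. relatively_invariant_measure \<phi> \<psi> q \<mu>) \<and>
         (\<forall>\<mu>. relatively_invariant_measure \<phi> \<psi> q \<mu> \<longrightarrow> fully_supported q \<mu>)"
proof -
  have cpt: "compact (UNIV :: 'k set)" and qc: "continuous_on UNIV q" and qs: "surj q"
    and qo: "\<And>U. open U \<Longrightarrow> open (q ` U)" and eqv: "\<And>g x. q (\<phi> g x) = \<psi> g (q x)"
    and \<phi>c: "continuous_on UNIV (\<lambda>(g, x). \<phi> g x)"
    and act: "\<And>x. \<phi> 0 x = x" "\<And>g h x. \<phi> (g + h) x = \<phi> g (\<phi> h x)"
      "\<And>l. \<psi> 0 l = l" "\<And>g h l. \<psi> (g + h) l = \<psi> g (\<psi> h l)"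
    using assms(1) unfolding open_extension_def extension_def top_dyn_sys_def open_map_def
    by (auto simp: fun_eq_iff)
  obtain E where "separating_kernels \<phi> q E"
    using pseudoisometric_kernels[OF cpt qc assms(2)] eqv by auto
  then have E: "\<And>p. p \<in> E \<Longrightarrow> continuous_on UNIV p"
    "\<And>p l. p \<in> E \<Longrightarrow> pseudometric_on {x. q x = l} p"
    "\<And>p x y g. p \<in> E \<Longrightarrow> q x = q y \<Longrightarrow> p (\<phi> g x, \<phi> g y) = p (x, y)"
    "\<And>x y. q x = q y \<Longrightarrow> x \<noteq> y \<Longrightarrow> \<exists>p\<in>E. 0 < p (x, y)"
    by (simp_all add: separating_kernels_def)
  have pm: "0 \<le> p (x, y)" "p (x, x) = 0" "p (x, y) = p (y, x)" "p (x, z) \<le> p (x, y) + p (y, z)"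
    if "p \<in> E" "q x = q y" "q y = q z" for p x y z
    using E(2)[OF that(1), of "q x"] that(2,3) unfolding pseudometric_on_def by auto
  \<comment> \<open>Finite sums with repetitions: closed under addition, and multiples of a positive value exceed any bound.\<close>
  define S where "S ps x y = (\<Sum>p\<leftarrow>ps. p (x, y))" for ps :: "('k \<times> 'k \<Rightarrow> real) list" and x y
  define D where "D = S ` lists E"
  have S_Cons: "S (p # ps) x y = p (x, y) + S ps x y" and S_Nil: "S [] x y = 0" for p ps x y
    by (simp_all add: S_def)
  interpret isometric_action q D \<phi> \<psi>
  proof
    show "D \<noteq> {}" by (auto simp: D_def)
    show "(\<lambda>x y. d x y + e x y) \<in> D" if d: "d \<in> D" "e \<in> D" for d e
    proof -
      obtain ps qs where "ps \<in> lists E" "d = S ps" "qs \<in> lists E" "e = S qs"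
        using d unfolding D_def by blast
      then show ?thesis
        unfolding D_def by (intro image_eqI[of _ _ "ps @ qs"]) (auto simp: S_def fun_eq_iff)
    qed
    fix d assume "d \<in> D"
    then obtain ps where ps: "ps \<in> lists E" "d = S ps" unfolding D_def by blast
    show "continuous_on UNIV (\<lambda>(x, y). d x y)"
      unfolding ps(2) using ps(1)
    proof induction
      case (Cons p ps)
      then show ?case using continuous_on_add[OF E(1)[OF Cons(1)] Cons(3)]
        by (simp add: S_Cons split_beta)
    qed (simp add: S_Nil split_beta)
    show "d x x = 0" for x
      unfolding ps(2) using ps(1) by induction (auto simp: S_Cons S_Nil pm(2))
    fix x y assume xy: "q x = q y"
    show "0 \<le> d x y"
      unfolding ps(2) using ps(1) by induction (auto simp: S_Cons S_Nil intro!: add_nonneg_nonneg pm(1) xy)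
    show "d x y = d y x"
      unfolding ps(2) using ps(1) by induction (auto simp: S_Cons S_Nil pm(3) xy)
    show "d x z \<le> d x y + d y z" if "q y = q z" for z
      unfolding ps(2) using ps(1)
    proof induction
      case (Cons p ps)
      then show ?case using pm(4)[OF Cons(1) xy that] by (simp add: S_Cons)
    qed (simp add: S_Nil)
    show "d (\<phi> g x) (\<phi> g y) = d x y" for g
      unfolding ps(2) using ps(1) by induction (auto simp: S_Cons S_Nil E(3) xy)
  next
    fix x y assume xy: "q x = q y" "x \<noteq> y"
    then obtain p where p: "p \<in> E" "0 < p (x, y)" using E(4) by blast
    then obtain n :: nat where "1 < real n * p (x, y)" using reals_Archimedean3 by blast
    moreover have "S (replicate n p) x y = real n * p (x, y)" by (simp add: S_def sum_list_replicate)
    moreover have "S (replicate n p) \<in> D" unfolding D_def using p by (auto intro!: imageI)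
    ultimately show "\<exists>d\<in>D. 1 < d x y" by (intro bexI) auto
  next
    show "continuous_on UNIV (\<phi> g)" for g
      using continuous_on_compose2[OF \<phi>c, of UNIV "\<lambda>x. (g, x)"] by (simp add: continuous_on_Pair)
    fix f :: "'k \<Rightarrow> real" and x y
    assume f: "continuous_on UNIV f" "\<And>g x. f (\<phi> g x) = f x"
    then have "(\<lambda>x. complex_of_real (f x)) \<in> cont_funs"
      by (auto simp: cont_funs_def intro!: continuous_intros)
    moreover have "(\<lambda>x. complex_of_real (f x)) \<circ> \<phi> g = (\<lambda>x. complex_of_real (f x))" for g
      by (simp add: fun_eq_iff f(2))
    ultimately have "(\<lambda>x. complex_of_real (f x)) constant_on UNIV"
      using assms(3) unfolding top_ergodic_def by blast
    then show "f x = f y" unfolding constant_on_def by (metis UNIV_I of_real_eq_iff)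
  qed (fact cpt qc qs qo act eqv)+
  show ?thesis
    using relatively_invariant_fibre_measure relatively_invariant_unique relatively_invariant_fully_supported
    by blast
qed

end
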